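(* Let $\varphi$ be the random homeomorphism of $[0,1]$ defined in the context. If $T$ is an interval property (as defined in the context) and $f\in C(\mathbb{T})$ is any function, then $$\mathbb{P}\left(T(f\circ\varphi)=1\right)\in\{0,1\}.$$
   Context: $\mathbb{T}$ is the circle group, identified with $[0,1]$ with endpoints glued; $C(\mathbb{T})$ is the space of continuous functions on $\mathbb{T}$ with the supremum norm. Random homeomorphism: let $X_{n,k}$ ($n\ge 1$, $0<k<2^n$ odd) be independent random variables uniform on $[0,1]$. Set $\varphi(0)=0$, $\varphi(1)=1$ and, inductively in $n$, for odd $0<k<2^n$, $$\varphi(k2^{-n})=\varphi((k-1)2^{-n})+X_{n,k}\left(\varphi((k+1)2^{-n})-\varphi((k-1)2^{-n})\right).$$ This defines an increasing function on the dyadic rationals, which almost surely extends to a homeomorphism of $[0,1]$, again denoted $\varphi$. Since $\varphi$ fixes $0$ and $1$, $f\circ\varphi\in C(\mathbb{T})$ for $f\in C(\mathbb{T})$. Interval property: a map $T$ assigning a value $T(f;I)\in\{0,1\}$ to every $f\in C(\mathbb{T})$ and every closed interval $I=[x,y]\subset[0,1]$ ($x\le y$) is called an interval property if: 1. $T$, considered as a map $(f,(x,y))\mapsto T(f;[x,y])$ on $C(\mathbb{T})\times\{(x,y)\in[0,1]^2: x\le y\}$, is Borel measurable; 2. if $f|_I=g|_I$ almost everywhere then $T(f;I)=T(g;I)$; 3. $T(f;[x,y])=T(f;[x,t])\,T(f;[t,y])$ whenever $x\le t\le y$, and $T(f;[x,x])=1$; 4. $T(f\circ L;L^{-1}(I))=T(f;I)$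 for any linear map $L$; precisely: if $L(u)=au+b$ with $a\neq0$, $I,J\subset[0,1]$ are closed intervals with $L(J)=I$, and $f,g\in C(\mathbb{T})$ satisfy $g(u)=f(L(u))$ for all $u\in J$, then $T(g;J)=T(f;I)$. Notation: $T(f):=T(f;[0,1])$. *)

theory Defs
  imports "HOL-Probability.Probability"
begin

text \<open>
  \<open>C(\<T>)\<close> is realised as the set of continuous 1-periodic functions on the real line, with the
  supremum metric of \<open>\<Rightarrow>\<^sub>C\<close>. The sort \<open>{real_normed_field, euclidean_space}\<close> is used for the
  scalars because it covers exactly the real and the complex case.
\<close>

definition circle_fun :: "(real \<Rightarrow>\<^sub>C 'b::{real_normed_field, euclidean_space}) set" where
  "circle_fun = {f. \<forall>x. apply_bcontfun f (x + 1) = apply_bcontfun f x}"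

text \<open>
  The 1-periodic function that equals \<open>f \<circ> h\<close> on \<open>[0,1]\<close>. It is meaningful when \<open>h\<close> is a continuous
  self-map of \<open>[0,1]\<close> that fixes 0 and 1 (see the lemmas below); only the restriction of \<open>h\<close>
  to \<open>[0,1)\<close> enters the formula.
\<close>

definition circle_comp ::
  "(real \<Rightarrow>\<^sub>C 'b::{real_normed_field, euclidean_space}) \<Rightarrow> (real \<Rightarrow> real) \<Rightarrow> (real \<Rightarrow>\<^sub>C 'b)" where
  "circle_comp f h = Bcontfun (\<lambda>x. f (h (frac x)))"

lemma circle_comp_bcontfun:
  fixes f :: "real \<Rightarrow>\<^sub>C 'b::{real_normed_field, euclidean_space}"
  assumes f: "f \<in> circle_fun" and h: "continuous_on {0..1} h" "h 0 = 0" "h 1 = 1"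
  shows "(\<lambda>x::real. f (h (frac x))) \<in> bcontfun"
proof -
  let ?g = "\<lambda>x::real. f (h (frac x))"
  have f01: "f 1 = f 0"
    using f by (auto simp: circle_fun_def dest: spec[of _ 0])
  have piece: "continuous_on {of_int n..of_int n + 1} ?g" for n :: int
  proof -
    have eq: "?g x = f (h (x - of_int n))" if "x \<in> {of_int n..of_int n + 1}" for x
    proof (cases "x = of_int n + 1")
      case True
      then have "frac x = 0" by simp
      then show ?thesis using True h f01 by simp
    next
      case False
      then have "\<lfloor>x\<rfloor> = n" using that by (auto simp: floor_eq_iff)
      then show ?thesis by (simp add: frac_def)
    qed
    have "continuous_on {of_int n..of_int n + 1} (\<lambda>x. h (x - of_int n))"
      by (rule continuous_on_compose2[OF h(1)]) (auto intro!: continuous_intros)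
    then have "continuous_on {of_int n..of_int n + 1} (\<lambda>x. f (h (x - of_int n)))"
      by (rule continuous_on_compose2[OF continuous_on_apply_bcontfun[of UNIV f]]) auto
    then show ?thesis
      by (rule continuous_on_eq) (simp add: eq)
  qed
  have "isCont ?g x" for x
  proof -
    let ?n = "\<lfloor>x\<rfloor>"
    have "continuous_on ({of_int (?n - 1)..of_int (?n - 1) + 1} \<union> {of_int ?n..of_int ?n + 1}) ?g"
      by (intro continuous_on_closed_Un piece) auto
    moreover have "{of_int (?n - 1)<..<of_int ?n + 1} \<subseteq>
        {of_int (?n - 1)..of_int (?n - 1) + 1} \<union> {of_int ?n..of_int ?n + (1::real)}"
      by auto
    ultimately have "continuous_on {of_int (?n - 1)<..<of_int ?n + 1} ?g"
      by (rule continuous_on_subset)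
    moreover have "x \<in> {of_int (?n - 1)<..<of_int ?n + 1}"
      by simp linarith
    ultimately show ?thesis
      by (simp add: continuous_on_eq_continuous_at)
  qed
  then have "continuous_on UNIV ?g"
    by (simp add: continuous_on_eq_continuous_at)
  moreover have "bounded (range ?g)"
    by (rule bounded_subset[OF bounded_apply_bcontfun[of f]]) auto
  ultimately show ?thesis
    by (simp add: bcontfun_def)
qed

lemma circle_comp_in_circle_fun:
  assumes "f \<in> circle_fun" "continuous_on {0..1} h" "h 0 = 0" "h 1 = 1"
  shows "circle_comp f h \<in> circle_fun"
  using circle_comp_bcontfun[OF assms]
  by (simp add: circle_comp_def circle_fun_def Bcontfun_inverse frac_1_eq)

lemma circle_comp_apply:
  assumes "f \<in> circle_fun" "continuous_on {0..1} h" "h 0 = 0" "h 1 = 1" "x \<in> {0..1}"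
  shows "circle_comp f h x = f (h x)"
proof (cases "x = 1")
  case True
  then show ?thesis
    using assms circle_comp_bcontfun[OF assms(1-4)]
    by (auto simp: circle_comp_def circle_fun_def Bcontfun_inverse dest: spec[of _ 0])
next
  case False
  then show ?thesis
    using assms circle_comp_bcontfun[OF assms(1-4)]
    by (simp add: circle_comp_def Bcontfun_inverse)
qed

text \<open>
  For a fixed array \<open>X\<close> of values, the recursion determines \<open>h\<close> on the dyadic rationals of \<open>[0,1]\<close>,
  so by continuity there is at most one such \<open>h\<close> up to its values outside \<open>[0,1]\<close>.
\<close>

definition dyadic_homeo :: "(nat \<Rightarrow> nat \<Rightarrow> real) \<Rightarrow> (real \<Rightarrow> real) \<Rightarrow> bool" where
  "dyadic_homeo X h \<longleftrightarrow>
     (\<exists>g. homeomorphism {0..1} {0..1} h g) \<and> h 0 = 0 \<and> h 1 = 1 \<and>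
     (\<forall>n k. 1 \<le> n \<longrightarrow> odd k \<longrightarrow> k < 2 ^ n \<longrightarrow>
        h (real k / 2 ^ n) =
          h ((real k - 1) / 2 ^ n) +
          X n k * (h ((real k + 1) / 2 ^ n) - h ((real k - 1) / 2 ^ n)))"

text \<open>
  When the values on the dyadic rationals do not extend to a homeomorphism (a null event for
  independent uniform \<open>X n k\<close>) the identity is taken as a default.
\<close>

definition random_homeo :: "(nat \<Rightarrow> nat \<Rightarrow> real) \<Rightarrow> real \<Rightarrow> real" where
  "random_homeo X =
     (if \<exists>h. dyadic_homeo X h then (SOME h. dyadic_homeo X h) else (\<lambda>x. x))"

text \<open>
  Only the values \<open>T f {x..y}\<close> with \<open>f \<in> circle_fun\<close> and \<open>0 \<le> x \<le> y \<le> 1\<close> are constrained.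
\<close>

definition interval_property ::
  "((real \<Rightarrow>\<^sub>C 'b::{real_normed_field, euclidean_space}) \<Rightarrow> real set \<Rightarrow> nat) \<Rightarrow> bool" where
  "interval_property T \<longleftrightarrow>
     (\<forall>f\<in>circle_fun. \<forall>x y. 0 \<le> x \<longrightarrow> x \<le> y \<longrightarrow> y \<le> 1 \<longrightarrow> T f {x..y} \<in> {0, 1}) \<and>
     (\<lambda>(f, x, y). T f {x..y}) \<in>
       borel_measurable (restrict_space borel (circle_fun \<times> {(x, y). 0 \<le> x \<and> x \<le> y \<and> y \<le> 1})) \<and>
     (\<forall>f\<in>circle_fun. \<forall>g\<in>circle_fun. \<forall>x y. 0 \<le> x \<longrightarrow> x \<le> y \<longrightarrow> y \<le> 1 \<longrightarrow>
        (AE u in lborel. u \<in> {x..y} \<longrightarrow> apply_bcontfun f u = apply_bcontfun g u) \<longrightarrow> T f {x..y} = T g {x..y}) \<and>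
     (\<forall>f\<in>circle_fun. \<forall>x t y. 0 \<le> x \<longrightarrow> x \<le> t \<longrightarrow> t \<le> y \<longrightarrow> y \<le> 1 \<longrightarrow>
        T f {x..y} = T f {x..t} * T f {t..y}) \<and>
     (\<forall>f\<in>circle_fun. \<forall>x. 0 \<le> x \<longrightarrow> x \<le> 1 \<longrightarrow> T f {x..x} = 1) \<and>
     (\<forall>f\<in>circle_fun. \<forall>g\<in>circle_fun. \<forall>a b x y x' y'.
        a \<noteq> 0 \<longrightarrow> 0 \<le> x \<longrightarrow> x \<le> y \<longrightarrow> y \<le> 1 \<longrightarrow> 0 \<le> x' \<longrightarrow> x' \<le> y' \<longrightarrow> y' \<le> 1 \<longrightarrow>
        (\<lambda>u. a * u + b) ` {x'..y'} = {x..y} \<longrightarrow>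
        (\<forall>u\<in>{x'..y'}. apply_bcontfun g u = apply_bcontfun f (a * u + b)) \<longrightarrow>
        T g {x'..y'} = T f {x..y})"

end

theory Submission
  imports Defs
begin

text \<open>
  For reals \<open>x\<close>, \<open>y\<close> let \<open>p x y\<close> be the probability that \<open>u \<mapsto> f (x + (y - x) * \<phi> u)\<close> has the interval
  property on the whole interval. As the two halves of \<open>\<phi>\<close> are independent rescaled copies of \<open>\<phi>\<close>,
  which meet at a uniform height, \<open>p x y\<close> is the average of \<open>p x z * p z y\<close> over \<open>z\<close> uniform
  between \<open>x\<close> and \<open>y\<close>. The main point is that \<open>p x z * p z y = p x y\<close> for almost every \<open>z\<close>. To
  see it, let \<open>v\<close> be the variance of \<open>h z = p x z * p z y - p x y\<close>, choose \<open>n\<close> independent uniform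
  points, and let \<open>W \<le> 1\<close> be the product of \<open>p\<close> over the \<open>n + 1\<close> gaps that they leave. The averaging
  identity allows one to drop points in expectation, so \<open>W\<close> has inner product \<open>v\<close> with \<open>h\<close> of each of the
  points; as these functions are orthogonal, Bessel's inequality gives \<open>n * v \<le> 1\<close> for all \<open>n\<close>, and
  \<open>v = 0\<close>. Hence knowing finitely many of the \<open>X n k\<close> does not change the probability of the event, which is
  therefore independent of itself.
\<close>

section \<open>Uniform measure on the unit interval\<close>

text \<open>Averaging alone gives no hold on a single splitting point: \<open>p x z * p z y\<close>
  could fluctuate around its mean \<open>p x y\<close>, and ruling this out takes many points at
  once. For each pair \<open>x\<close>, \<open>y\<close> the identity holds outside a null set of
  \<open>z\<close>; this suffices, because a root value is uniform and avoids that null set almost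
  surely. Half of \<open>f \<circ> \<phi>\<close> is \<open>f\<close> composed with an independent
  copy of \<open>\<phi>\<close> squeezed between random heights, so the zero-one law concerns all
  events indexed by two real endpoints at once, jointly measurable in endpoints and tree. Such a
  half need not take equal values at its two ends; it is therefore carried on
  \<open>{0..1/2}\<close> and reflected onto the rest of the circle. The event that an array
  produces a homeomorphism splits at the root as well, and the same zero-one law settles the default
  value of \<open>random_homeo\<close>.\<close>

definition unif :: "real measure" where
  "unif = uniform_measure lborel {0..1}"

lemma space_unif [simp]: "space unif = UNIV"
  by (simp add: unif_def)

lemma sets_unif [simp, measurable_cong]: "sets unif = sets borel"
  by (simp add: unif_def)

lemma borel_measurable_unifI: "f \<in> borel_measurable borel \<Longrightarrow> f \<in> borel_measurable unif"
  by (simp cong: measurable_cong_sets)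

lemma prob_space_unif: "prob_space unif"
  unfolding unif_def by (rule prob_space_uniform_measure) auto

lemma measure_unif_UNIV [simp]: "measure unif UNIV = 1"
  using prob_space.prob_space[OF prob_space_unif] by simp

lemma AE_unif_iff: "(AE t in unif. P t) \<longleftrightarrow> (AE t in lborel. t \<in> {0..1} \<longrightarrow> P t)"
  unfolding unif_def by (rule AE_uniform_measure) auto

lemma AE_unif_open: "AE t in unif. t \<in> {0<..<1}"
proof -
  have "AE t in lborel. t \<noteq> (0::real)" "AE t in lborel. t \<noteq> (1::real)"
    by (auto intro: AE_lborel_singleton)
  then show ?thesis unfolding AE_unif_iff by eventually_elim auto
qed

lemma integral_unif:
  fixes f :: "real \<Rightarrow> real"
  assumes [measurable]: "f \<in> borel_measurable borel"
  shows "(\<integral>t. f t \<partial>unif) = (\<integral>t. indicator {0..1} t * f t \<partial>lborel)"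
proof -
  have "unif = density lborel (\<lambda>t. ennreal (indicator {0..1} t))"
    by (simp add: unif_def uniform_measure_def ennreal_indicator divide_ennreal_def)
  then have "(\<integral>t. f t \<partial>unif) = (\<integral>t. f t \<partial>density lborel (\<lambda>t. ennreal (indicator {0..1} t)))"
    by (rule arg_cong)
  also have "\<dots> = (\<integral>t. indicator {0..1} t *\<^sub>R f t \<partial>lborel)"
    by (rule integral_density) auto
  finally show ?thesis by simp
qed

section \<open>Gaps of finite sets\<close>

text \<open>For finite \<open>S\<close> these are the pairs of neighbours. Sampled points may come
  in any order and may coincide, which a set absorbs and a sorted list would not.\<close>

definition gaps :: "real set \<Rightarrow> (real \<times> real) set" where
  "gaps S = {(a, b). a \<in> S \<and> b \<in> S \<and> a < b \<and> S \<inter> {a<..<b} = {}}"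

lemma gaps_subset: "gaps S \<subseteq> S \<times> S"
  by (auto simp: gaps_def)

lemma finite_gaps: "finite S \<Longrightarrow> finite (gaps S)"
  by (rule finite_subset[OF gaps_subset]) auto

lemma gap_exists:
  assumes "finite S" "a\<^sub>0 \<in> S" "b\<^sub>0 \<in> S" "a\<^sub>0 < t" "t < b\<^sub>0" "t \<notin> S"
  obtains a b where "(a, b) \<in> gaps S" "a < t" "t < b"
proof -
  let ?A = "{s \<in> S. s < t}" and ?B = "{s \<in> S. t < s}"
  have A: "finite ?A" "?A \<noteq> {}" and B: "finite ?B" "?B \<noteq> {}"
    using assms by auto
  have a: "Max ?A \<in> ?A" and b: "Min ?B \<in> ?B"
    using Max_in[OF A] Min_in[OF B] by auto
  have "False" if "s \<in> S" "Max ?A < s" "s < Min ?B" for s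
  proof (cases "s < t")
    case True
    then show False using Max_ge[OF A(1), of s] that by auto
  next
    case False
    then have "t < s" using that assms(6) by (cases "s = t") auto
    then show False using Min_le[OF B(1), of s] that by auto
  qed
  then have "(Max ?A, Min ?B) \<in> gaps S"
    using a b by (auto simp: gaps_def)
  then show thesis using that a b by auto
qed

lemma gaps_disjoint:
  assumes "(a, b) \<in> gaps S" "(c, d) \<in> gaps S" "a < t" "t < b" "c < t" "t < d"
  shows "a = c \<and> b = d"
proof -
  have "\<not> (c < a)" "\<not> (a < c)" "\<not> (b < d)" "\<not> (d < b)"
    using assms by (auto simp: gaps_def dest: order.strict_trans)
  then show ?thesis by auto
qed

text \<open>A new point disturbs only the gap that contains it. This lets an identity about one gap
  act on a product over all gaps.\<close>

lemma gaps_insert: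
  assumes "(a, b) \<in> gaps S" "a < t" "t < b"
  shows "gaps (insert t S) = insert (a, t) (insert (t, b) (gaps S - {(a, b)}))"
proof -
  have ab: "a \<in> S" "b \<in> S" "\<And>s. s \<in> S \<Longrightarrow> s \<le> a \<or> b \<le> s"
    using assms(1) by (auto simp: gaps_def)
  have t: "t \<notin> S"
    using assms ab(3)[of t] by auto
  show ?thesis
  proof (intro set_eqI iffI)
    fix z assume "z \<in> gaps (insert t S)"
    then obtain c d where z: "z = (c, d)" "c \<in> insert t S" "d \<in> insert t S" "c < d"
      "\<And>s. s \<in> insert t S \<Longrightarrow> \<not> (c < s \<and> s < d)"
      by (auto simp: gaps_def disjoint_iff)
    show "z \<in> insert (a, t) (insert (t, b) (gaps S - {(a, b)}))"
    proof (cases "c = t \<or> d = t")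
      case True
      then show ?thesis
      proof
        assume "c = t"
        then have "d \<in> S" using z by auto
        then have "d = b"
          using \<open>c = t\<close> z(4) z(5)[of b] ab(3)[of d] ab(2) assms(2,3) by force
        then show ?thesis using \<open>c = t\<close> z(1) by simp
      next
        assume "d = t"
        then have "c \<in> S" using z by auto
        then have "c = a"
          using \<open>d = t\<close> z(4) z(5)[of a] ab(3)[of c] ab(1) assms(2,3) by force
        then show ?thesis using \<open>d = t\<close> z(1) by simp
      qed
    next
      case False
      then have "(c, d) \<in> gaps S"
        using z by (auto simp: gaps_def)
      moreover have "(c, d) \<noteq> (a, b)"
        using z(5)[of t] assms by auto
      ultimately show ?thesis using z(1) by auto
    qed
  next
    fix z assume "z \<in> insert (a, t) (insert (t, b) (gaps S - {(a, b)}))"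
    then consider "z = (a, t)" | "z = (t, b)" | "z \<in> gaps S" "z \<noteq> (a, b)" by auto
    then show "z \<in> gaps (insert t S)"
    proof cases
      case 1
      then show ?thesis using ab assms(2,3) by (auto simp: gaps_def dest: ab(3))
    next
      case 2
      then show ?thesis using ab assms(2,3) by (auto simp: gaps_def dest: ab(3))
    next
      case 3
      obtain c d where "z = (c, d)" by (cases z)
      then have "\<not> (c < t \<and> t < d)"
        using 3 gaps_disjoint[OF assms(1), of c d t] assms(2,3) by auto
      then show ?thesis using 3 \<open>z = (c, d)\<close> by (auto simp: gaps_def)
    qed
  qed
qed

text \<open>The index set of the product varies with \<open>w\<close>. Over the fixed set
  \<open>I \<times> I\<close> of index pairs it becomes a finite product whose factors are switched
  on by measurable conditions.\<close>

lemma borel_measurable_prod_gaps: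
  fixes u :: "nat \<Rightarrow> 'n \<Rightarrow> real" and p :: "real \<Rightarrow> real \<Rightarrow> real"
  assumes I: "finite I"
    and u: "\<And>i. i \<in> I \<Longrightarrow> u i \<in> borel_measurable N"
    and p: "(\<lambda>z. p (fst z) (snd z)) \<in> borel_measurable (borel \<Otimes>\<^sub>M borel)"
  shows "(\<lambda>w. \<Prod>(a, b)\<in>gaps ((\<lambda>i. u i w) ` I). p a b) \<in> borel_measurable N"
proof -
  txt \<open>A point may be attained by several indices; only the least one is counted.\<close>
  define C where "C w i j \<longleftrightarrow> u i w < u j w \<and> (\<forall>k\<in>I. \<not> (u i w < u k w \<and> u k w < u j w))
    \<and> (\<forall>k\<in>I. k < i \<longrightarrow> u k w \<noteq> u i w) \<and> (\<forall>k\<in>I. k < j \<longrightarrow> u k w \<noteq> u j w)" for w i j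
  have eq: "(\<Prod>(a, b)\<in>gaps ((\<lambda>i. u i w) ` I). p a b) =
      (\<Prod>(i, j)\<in>I \<times> I. if C w i j then p (u i w) (u j w) else 1)" for w
  proof -
    let ?R = "{(i, j). i \<in> I \<and> j \<in> I \<and> C w i j}"
    have least: "\<exists>i\<in>I. u i w = s \<and> (\<forall>k\<in>I. k < i \<longrightarrow> u k w \<noteq> u i w)"
      if s: "s \<in> (\<lambda>i. u i w) ` I" for s
    proof -
      obtain j where "j \<in> I \<and> u j w = s" using s by blast
      then have L: "(LEAST j. j \<in> I \<and> u j w = s) \<in> I \<and> u (LEAST j. j \<in> I \<and> u j w = s) w = s"
        by (rule LeastI)
      show ?thesis
        using L not_less_Least[where P = "\<lambda>j. j \<in> I \<and> u j w = s"] by metis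
    qed
    have inj: "inj_on (\<lambda>(i, j). (u i w, u j w)) ?R"
    proof (rule inj_onI, clarsimp)
      fix i j i' j'
      assume *: "C w i j" "C w i' j'" "i \<in> I" "j \<in> I" "i' \<in> I" "j' \<in> I" "u i w = u i' w" "u j w = u j' w"
      have "\<not> i < i'" "\<not> i' < i" "\<not> j < j'" "\<not> j' < j"
        using * unfolding C_def by metis+
      then show "i = i' \<and> j = j'" by auto
    qed
    have img: "(\<lambda>(i, j). (u i w, u j w)) ` ?R = gaps ((\<lambda>i. u i w) ` I)"
    proof (intro set_eqI iffI)
      fix z assume "z \<in> (\<lambda>(i, j). (u i w, u j w)) ` ?R"
      then show "z \<in> gaps ((\<lambda>i. u i w) ` I)"
        by (auto simp: C_def gaps_def)
    next
      fix z assume "z \<in> gaps ((\<lambda>i. u i w) ` I)"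
      then obtain a b where z: "z = (a, b)" "a \<in> (\<lambda>i. u i w) ` I" "b \<in> (\<lambda>i. u i w) ` I" "a < b"
        "\<And>k. k \<in> I \<Longrightarrow> \<not> (a < u k w \<and> u k w < b)"
        by (auto simp: gaps_def disjoint_iff)
      obtain i j where "i \<in> I" "u i w = a" "\<forall>k\<in>I. k < i \<longrightarrow> u k w \<noteq> u i w"
        "j \<in> I" "u j w = b" "\<forall>k\<in>I. k < j \<longrightarrow> u k w \<noteq> u j w"
        using least[OF z(2)] least[OF z(3)] by auto
      then show "z \<in> (\<lambda>(i, j). (u i w, u j w)) ` ?R"
        using z by (intro image_eqI[where x = "(i, j)"]) (auto simp: C_def)
    qed
    have "(\<Prod>(a, b)\<in>gaps ((\<lambda>i. u i w) ` I). p a b) = (\<Prod>(i, j)\<in>?R. p (u i w) (u j w))"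
      unfolding img[symmetric] by (subst prod.reindex[OF inj]) (auto intro!: prod.cong)
    also have "\<dots> = (\<Prod>(i, j)\<in>I \<times> I. if C w i j then p (u i w) (u j w) else 1)"
      by (rule prod.mono_neutral_cong_left) (auto simp: I split: if_splits)
    finally show ?thesis .
  qed
  have "(\<lambda>w. if C w i j then p (u i w) (u j w) else 1) \<in> borel_measurable N"
    if "i \<in> I" "j \<in> I" for i j
  proof -
    note u[OF that(1), measurable] u[OF that(2), measurable]
    have [measurable]: "(\<lambda>w. p (u i w) (u j w)) \<in> borel_measurable N"
      using measurable_compose[OF measurable_Pair[OF u[OF that(1)] u[OF that(2)]] p] by simp
    have 1: "Measurable.pred N (\<lambda>w. \<forall>k\<in>I. \<not> (u i w < u k w \<and> u k w < u j w))"
      "Measurable.pred N (\<lambda>w. \<forall>k\<in>I. k < i \<longrightarrow> u k w \<noteq> u i w)"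
      "Measurable.pred N (\<lambda>w. \<forall>k\<in>I. k < j \<longrightarrow> u k w \<noteq> u j w)"
      using that u by (auto intro!: pred_intros_finite I)
    have "Measurable.pred N (\<lambda>w. u i w < u j w)"
      by measurable
    then have "Measurable.pred N (\<lambda>w. C w i j)"
      unfolding C_def by (intro pred_intros_logic 1)
    then show ?thesis
      by (intro measurable_If) auto
  qed
  then show ?thesis
    unfolding eq by (intro borel_measurable_prod) (simp add: case_prod_beta mem_Times_iff)
qed

section \<open>Kernels that average over a splitting point\<close>

text \<open>The variance argument uses only these facts about the probabilities \<open>p\<close>.
  The kernel is total on pairs of reals, so measurability and bounds carry no side conditions on the
  endpoints.\<close>

locale split_kernel =
  fixes p :: "real \<Rightarrow> real \<Rightarrow> real"
  assumes measurable_kernel: "(\<lambda>z. p (fst z) (snd z)) \<in> borel_measurable (borel \<Otimes>\<^sub>M borel)"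
    and kernel_nonneg: "\<And>a b. 0 \<le> p a b"
    and kernel_le_1: "\<And>a b. p a b \<le> 1"
    and kernel_average:
      "\<And>a b. a < b \<Longrightarrow> (\<integral>t. p a (a + t * (b - a)) * p (a + t * (b - a)) b \<partial>unif) = p a b"
begin

lemma measurable_p [measurable (raw)]:
  assumes "u \<in> borel_measurable N" "v \<in> borel_measurable N"
  shows "(\<lambda>w. p (u w) (v w)) \<in> borel_measurable N"
  using measurable_compose[OF measurable_Pair[OF assms] measurable_kernel] by simp

text \<open>In the application this is the probability that independent copies of the random map,
  one for each gap of \<open>S\<close>, all have the property.\<close>

definition Q :: "real set \<Rightarrow> real" where
  "Q S = (\<Prod>(a, b)\<in>gaps S. p a b)"

lemma Q_nonneg: "0 \<le> Q S"
  unfolding Q_def by (rule prod_nonneg) (auto simp: kernel_nonneg)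

lemma Q_le_1: "Q S \<le> 1"
  unfolding Q_def by (rule prod_le_1) (auto simp: kernel_nonneg kernel_le_1)

lemma Q_abs_le_1: "\<bar>Q S\<bar> \<le> 1"
  using Q_nonneg[of S] Q_le_1[of S] by simp

lemma Q_01: "Q {0, 1} = p 0 1"
proof -
  have "gaps {0, 1} = {(0, 1)}"
    by (auto simp: gaps_def)
  then show ?thesis by (simp add: Q_def)
qed

lemma measurable_Q:
  fixes u :: "nat \<Rightarrow> 'n \<Rightarrow> real"
  assumes I: "finite I" and u: "\<And>i. i \<in> I \<Longrightarrow> u i \<in> borel_measurable N"
  shows "(\<lambda>w. Q ({0, 1} \<union> (\<lambda>i. u i w) ` I)) \<in> borel_measurable N"
proof -
  \<comment> \<open>Indices 0 and 1 are reserved for the constant endpoints, so the given points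
    move up by two.\<close>
  define u' where "u' i w = (if i = 0 then 0 else if i = 1 then 1 else u (i - 2) w)" for i w
  have eq: "{0, 1} \<union> (\<lambda>i. u i w) ` I = (\<lambda>i. u' i w) ` ({0, 1} \<union> (\<lambda>i. i + 2) ` I)" for w
  proof -
    have "(\<lambda>i. u' i w) ` (\<lambda>i. i + 2) ` I = (\<lambda>i. u i w) ` I"
      unfolding image_image by (rule image_cong) (auto simp: u'_def)
    then show ?thesis by (simp only: image_Un) (simp add: u'_def insert_commute)
  qed
  have "u' i \<in> borel_measurable N" if "i \<in> {0, 1} \<union> (\<lambda>i. i + 2) ` I" for i
    using that u unfolding u'_def by auto
  then show ?thesis
    unfolding eq Q_def using I by (intro borel_measurable_prod_gaps measurable_kernel) auto
qed

lemma measurable_Q_insert: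
  assumes "finite S" "{0, 1} \<subseteq> S"
  shows "(\<lambda>t. Q (insert t S)) \<in> borel_measurable borel"
proof -
  obtain f and n :: nat where f: "S = f ` {..<n}"
    using finite_imp_nat_seg_image_inj_on[OF assms(1)] by (auto simp: lessThan_def)
  have eq: "insert t S = {0, 1} \<union> (\<lambda>i. if i = n then t else f i) ` {..n}" for t
  proof -
    have "(\<lambda>i. if i = n then t else f i) ` {..n} = insert t (f ` {..<n})"
      by (auto simp: le_less image_iff)
    then show ?thesis using assms(2) f by auto
  qed
  show ?thesis
    unfolding eq by (rule measurable_Q) auto
qed

text \<open>This is the averaging identity without normalisation. The factor \<open>b - a\<close> is
  the Jacobian of the substitution; inside \<open>[0, 1]\<close> it is also the probability that a
  uniform point falls into the gap.\<close>

lemma integral_gap: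
  assumes "a < b"
  shows "(\<integral>t. indicator {a..b} t * (p a t * p t b) \<partial>lborel) = (b - a) * p a b"
proof -
  have "(\<integral>t. indicator {a..b} t * (p a t * p t b) \<partial>lborel) =
     \<bar>b - a\<bar> *\<^sub>R (\<integral>t. indicator {a..b} (a + (b - a) * t) * (p a (a + (b - a) * t) * p (a + (b - a) * t) b) \<partial>lborel)"
    using assms by (intro lborel_integral_real_affine) auto
  also have "(\<lambda>t. indicator {a..b} (a + (b - a) * t) :: real) = indicator {0..1}"
  proof
    fix t
    have "a + (b - a) * t \<le> b \<longleftrightarrow> (b - a) * t \<le> (b - a) * 1" by (simp add: algebra_simps)
    also have "\<dots> \<longleftrightarrow> t \<le> 1" using assms by (simp only: mult_le_cancel_left_pos diff_gt_0_iff_gt)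
    finally show "indicator {a..b} (a + (b - a) * t) = (indicator {0..1} t :: real)"
      using assms by (auto simp: indicator_def zero_le_mult_iff)
  qed
  also have "(\<integral>t. indicator {0..1} t * (p a (a + (b - a) * t) * p (a + (b - a) * t) b) \<partial>lborel)
      = p a b"
    using kernel_average[OF assms] by (subst integral_unif[symmetric]) (auto simp: mult.commute)
  finally show ?thesis using assms by simp
qed

lemma Q_insert:
  assumes "finite S" "(a, b) \<in> gaps S" "a < t" "t < b"
  shows "Q (insert t S) = p a t * p t b * (\<Prod>(c, d)\<in>gaps S - {(a, b)}. p c d)"
proof -
  have "t \<notin> S" using assms(2-) by (auto simp: gaps_def)
  then have "(a, t) \<notin> gaps S" "(t, b) \<notin> gaps S" by (auto simp: gaps_def)
  then show ?thesis
    using assms finite_gaps[OF assms(1)] unfolding Q_def gaps_insert[OF assms(2-)]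
    by (simp add: mult.assoc)
qed

text \<open>A uniform point hits a gap with probability equal to its length and then splits only
  that factor, whose average is the old factor. Each gap thus contributes its length times
  \<open>Q S\<close>, and the lengths add up to 1.\<close>

lemma Q_insert_average:
  assumes S: "finite S" "{0, 1} \<subseteq> S" "S \<subseteq> {0..1}"
  shows "(\<integral>t. Q (insert t S) \<partial>unif) = Q S"
proof -
  let ?R = "\<lambda>z. \<Prod>(c, d)\<in>gaps S - {z}. p c d"
  have fin: "finite (gaps S)" by (rule finite_gaps[OF S(1)])
  \<comment> \<open>Off \<open>S\<close> exactly one closed gap contains \<open>t\<close>, so a sum
    over all gaps weighted by indicators picks out a single term.\<close>
  have only: "(\<Sum>z\<in>gaps S. indicator {fst z..snd z} t * F z) = F (a, b)"
    if t: "t \<notin> S" "a < t" "t < b" "(a, b) \<in> gaps S" for t a b and F :: "real \<times> real \<Rightarrow> real"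
  proof -
    have *: "z = (a, b)" if "z \<in> gaps S" "t \<in> {fst z..snd z}" for z
    proof (cases z)
      case (Pair c d)
      then have "c \<noteq> t" "d \<noteq> t" using that(1) t(1) by (auto simp: gaps_def)
      then show ?thesis
        using gaps_disjoint[OF t(4), of c d t] t that Pair by auto
    qed
    have "(\<Sum>z\<in>gaps S. indicator {fst z..snd z} t * F z)
        = (\<Sum>z\<in>gaps S. if z = (a, b) then F (a, b) else 0)"
    proof (rule sum.cong)
      fix z assume "z \<in> gaps S"
      then show "indicator {fst z..snd z} t * F z = (if z = (a, b) then F (a, b) else 0)"
        using *[of z] t(2,3) by (cases "z = (a, b)") (auto simp: indicator_def)
    qed (rule refl)
    also have "\<dots> = F (a, b)"
      using sum.delta[OF fin, of "(a, b)" "\<lambda>_. F (a, b)"] t(4) by simp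
    finally show ?thesis .
  qed
  have gap: "\<exists>a b. a < t \<and> t < b \<and> (a, b) \<in> gaps S" if "t \<in> {0..1}" "t \<notin> S" for t
  proof -
    have "t \<noteq> 0" "t \<noteq> 1" "0 \<in> S" "1 \<in> S" using that S(2) by auto
    then have "0 < t" "t < 1" using that(1) by auto
    then show ?thesis using gap_exists[OF S(1) \<open>0 \<in> S\<close> \<open>1 \<in> S\<close>, of t] that(2) by blast
  qed
  have AE_S: "AE t in lborel. t \<notin> S"
    by (rule AE_not_in) (auto simp: S(1) finite_imp_null_set_lborel)
  have [measurable]: "(\<lambda>t. Q (insert t S)) \<in> borel_measurable borel"
    by (rule measurable_Q_insert[OF S(1,2)])
  have sub: "indicator {0..1} t * indicator {fst z..snd z} t = (indicator {fst z..snd z} t :: real)"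
    if "z \<in> gaps S" for z t
    using that S(3) gaps_subset[of S] by (cases z) (force simp: indicator_def)
  have "(\<integral>t. Q (insert t S) \<partial>unif) = (\<integral>t. indicator {0..1} t * Q (insert t S) \<partial>lborel)"
    by (rule integral_unif) simp
  also have "\<dots> = (\<integral>t. (\<Sum>z\<in>gaps S. indicator {fst z..snd z} t * (p (fst z) t * p t (snd z) * ?R z)) \<partial>lborel)"
  proof (rule integral_cong_AE)
    show "AE t in lborel. indicator {0..1} t * Q (insert t S) =
      (\<Sum>z\<in>gaps S. indicator {fst z..snd z} t * (p (fst z) t * p t (snd z) * ?R z))"
      using AE_S
    proof eventually_elim
      fix t assume t: "t \<notin> S"
      show "indicator {0..1} t * Q (insert t S) =
        (\<Sum>z\<in>gaps S. indicator {fst z..snd z} t * (p (fst z) t * p t (snd z) * ?R z))"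
      proof (cases "t \<in> {0..1}")
        case True
        then obtain a b where ab: "a < t" "t < b" "(a, b) \<in> gaps S" using gap t by blast
        show ?thesis
          using True only[OF t ab] Q_insert[OF S(1) ab(3,1,2)] by simp
      next
        case False
        have "indicator {fst z..snd z} t = (0::real)" if "z \<in> gaps S" for z
          using sub[OF that, of t] False by simp
        then show ?thesis using False by simp
      qed
    qed
  qed auto
  also have "\<dots> = (\<Sum>z\<in>gaps S. \<integral>t. indicator {fst z..snd z} t * (p (fst z) t * p t (snd z) * ?R z) \<partial>lborel)"
  proof (rule Bochner_Integration.integral_sum)
    fix z assume "z \<in> gaps S"
    have "integrable lborel (\<lambda>t. indicator {fst z..snd z} t *\<^sub>R (p (fst z) t * p t (snd z) * ?R z))"
    proof (rule integrableI_bounded_set_indicator[where B = 1])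
      show "AE t in lborel. t \<in> {fst z..snd z} \<longrightarrow> norm (p (fst z) t * p t (snd z) * ?R z) \<le> 1"
      proof (intro AE_I2 impI)
        fix t
        have "0 \<le> ?R z" "?R z \<le> 1"
          by (auto intro!: prod_nonneg prod_le_1 simp: kernel_nonneg kernel_le_1)
        then show "norm (p (fst z) t * p t (snd z) * ?R z) \<le> 1"
          by (simp add: abs_mult kernel_nonneg kernel_le_1 mult_le_one)
      qed
    qed (auto simp: emeasure_lborel_Icc_eq)
    then show "integrable lborel (\<lambda>t. indicator {fst z..snd z} t * (p (fst z) t * p t (snd z) * ?R z))"
      by simp
  qed
  also have "\<dots> = (\<Sum>z\<in>gaps S. (snd z - fst z) * Q S)"
  proof (rule sum.cong)
    fix z assume z: "z \<in> gaps S"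
    then have "fst z < snd z" by (auto simp: gaps_def)
    have "(\<integral>t. indicator {fst z..snd z} t * (p (fst z) t * p t (snd z) * ?R z) \<partial>lborel)
        = (\<integral>t. indicator {fst z..snd z} t * (p (fst z) t * p t (snd z)) \<partial>lborel) * ?R z"
      by (simp flip: mult.assoc)
    also have "\<dots> = (snd z - fst z) * (p (fst z) (snd z) * ?R z)"
      using integral_gap[OF \<open>fst z < snd z\<close>] by simp
    also have "p (fst z) (snd z) * ?R z = Q S"
      unfolding Q_def using prod.remove[OF fin z, of "\<lambda>(a, b). p a b"] by (simp add: case_prod_beta)
    finally show "(\<integral>t. indicator {fst z..snd z} t * (p (fst z) t * p t (snd z) * ?R z) \<partial>lborel)
       = (snd z - fst z) * Q S" .
  qed simp
  also have "\<dots> = (\<Sum>z\<in>gaps S. snd z - fst z) * Q S"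
    by (simp add: sum_distrib_right)
  \<comment> \<open>The closed gaps cover \<open>[0, 1]\<close> and overlap only in
    \<open>S\<close>, a null set. Integrating their indicators gives the total length without
    enumerating \<open>S\<close> in increasing order.\<close>
  also have "(\<Sum>z\<in>gaps S. snd z - fst z) = 1"
  proof -
    have "(\<Sum>z\<in>gaps S. snd z - fst z) = (\<Sum>z\<in>gaps S. \<integral>t. indicator {fst z..snd z} t \<partial>lborel)"
      by (rule sum.cong) (auto simp: gaps_def)
    also have "\<dots> = (\<integral>t. (\<Sum>z\<in>gaps S. indicator {fst z..snd z} t) \<partial>lborel)"
      by (rule Bochner_Integration.integral_sum[symmetric]) (auto simp: emeasure_lborel_Icc_eq)
    also have "\<dots> = (\<integral>t. indicator {0..1::real} t \<partial>lborel)"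
    proof (rule integral_cong_AE)
      show "AE t in lborel. (\<Sum>z\<in>gaps S. indicator {fst z..snd z} t) = (indicator {0..1} t :: real)"
        using AE_S
      proof eventually_elim
        fix t assume t: "t \<notin> S"
        show "(\<Sum>z\<in>gaps S. indicator {fst z..snd z} t) = (indicator {0..1} t :: real)"
        proof (cases "t \<in> {0..1}")
          case True
          then obtain a b where ab: "a < t" "t < b" "(a, b) \<in> gaps S" using gap t by blast
          show ?thesis
            using True only[OF t ab, of "\<lambda>_. 1"] by simp
        next
          case False
          have "indicator {fst z..snd z} t = (0::real)" if "z \<in> gaps S" for z
            using sub[OF that, of t] False by simp
          then show ?thesis using False by simp
        qed
      qed
    qed auto
    finally show ?thesis by simp
  qed
  finally show ?thesis by simp
qed

end

section \<open>Expectations over finitely many independent uniform points\<close>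

lemma product_sigma_finite_unif: "product_sigma_finite (\<lambda>_. unif)"
  using prob_space_unif by (simp add: product_sigma_finite_def prob_space_imp_sigma_finite)

lemma prob_space_PiM_unif: "prob_space (PiM I (\<lambda>_. unif))"
  by (rule prob_space_PiM) (rule prob_space_unif)

lemma integrable_PiM_unif:
  fixes f :: "('i \<Rightarrow> real) \<Rightarrow> real"
  assumes "f \<in> borel_measurable (PiM I (\<lambda>_. unif))" "\<And>u. \<bar>f u\<bar> \<le> B"
  shows "integrable (PiM I (\<lambda>_. unif)) f"
proof -
  interpret prob_space "PiM I (\<lambda>_. unif) :: ('i \<Rightarrow> real) measure" by (rule prob_space_PiM_unif)
  show ?thesis using assms by (intro integrable_const_bound[where B = B]) auto
qed

lemma integral_PiM_unif_insert:
  fixes f :: "('i \<Rightarrow> real) \<Rightarrow> real"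
  assumes "finite I" "i \<notin> I" "f \<in> borel_measurable (PiM (insert i I) (\<lambda>_. unif))" "\<And>u. \<bar>f u\<bar> \<le> B"
  shows "integral\<^sup>L (PiM (insert i I) (\<lambda>_. unif)) f
    = (\<integral>u. (\<integral>t. f (u(i := t)) \<partial>unif) \<partial>PiM I (\<lambda>_. unif))"
  using product_sigma_finite.product_integral_insert[OF product_sigma_finite_unif assms(1,2)
      integrable_PiM_unif[OF assms(3,4)]] .

lemma AE_PiM_unif:
  assumes "finite I"
  shows "AE u in PiM I (\<lambda>_. unif). \<forall>i\<in>I. u i \<in> {0..1}"
  using assms
  by (auto intro!: AE_ball_countable' AE_PiM_component prob_space_unif countable_finite
      simp del: atLeastAtMost_iff simp: AE_unif_iff)

section \<open>Orthogonality and Bessel's inequality for the deviation\<close>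

context split_kernel
begin

text \<open>The function \<open>h\<close> of the overview for the endpoints 0 and 1. Expressed
  through \<open>Q\<close>, it makes \<open>W {i} u\<close> equal to
  \<open>p 0 1 + dev (u i)\<close> for every value of \<open>u i\<close>, endpoints
  included.\<close>

definition dev :: "real \<Rightarrow> real" where
  "dev t = Q {0, 1, t} - p 0 1"

definition W :: "nat set \<Rightarrow> (nat \<Rightarrow> real) \<Rightarrow> real" where
  "W I u = Q ({0, 1} \<union> u ` I)"

lemma W_abs_le_1: "\<bar>W I u\<bar> \<le> 1"
  unfolding W_def by (rule Q_abs_le_1)

lemma dev_abs_le_1: "\<bar>dev t\<bar> \<le> 1"
  using Q_nonneg[of "{0, 1, t}"] Q_le_1[of "{0, 1, t}"] kernel_nonneg[of 0 1] kernel_le_1[of 0 1]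
  unfolding dev_def by linarith

lemma sum_dev_bound: "\<bar>\<Sum>i\<in>J. dev (u i)\<bar> \<le> card J"
proof -
  have "\<bar>\<Sum>i\<in>J. dev (u i)\<bar> \<le> (\<Sum>i\<in>J. \<bar>dev (u i)\<bar>)"
    by (rule sum_abs)
  also have "\<dots> \<le> of_nat (card J) * 1"
    by (rule sum_bounded_above) (rule dev_abs_le_1)
  finally show ?thesis by simp
qed

lemma measurable_dev [measurable]: "dev \<in> borel_measurable borel"
proof -
  have "{0, 1, t} = insert t {0, 1}" for t :: real by auto
  then show ?thesis
    unfolding dev_def using measurable_Q_insert[of "{0, 1}"] by simp
qed

lemma measurable_W [measurable]:
  assumes "finite I" "I \<subseteq> J"
  shows "W I \<in> borel_measurable (PiM J (\<lambda>_. unif))"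
  unfolding W_def by (rule measurable_Q[OF assms(1)]) (use assms(2) in auto)

text \<open>A second moment, which is the variance because \<open>dev\<close> has mean zero by
  \<open>integral_dev\<close>.\<close>

definition dev_var :: real where
  "dev_var = (\<integral>t. (dev t)\<^sup>2 \<partial>unif)"

lemma integral_dev: "(\<integral>t. dev t \<partial>unif) = 0"
proof -
  interpret U: prob_space unif by (rule prob_space_unif)
  have [measurable]: "(\<lambda>t. Q (insert t {0, 1})) \<in> borel_measurable borel"
    by (rule measurable_Q_insert) auto
  have int: "integrable unif (\<lambda>t. Q (insert t {0, 1}))"
    by (rule U.integrable_const_bound[where B = 1]) (auto simp: Q_abs_le_1)
  have "(\<integral>t. Q (insert t {0, 1}) \<partial>unif) = p 0 1"
    using Q_insert_average[of "{0, 1}"] Q_01 by simp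
  moreover have "dev = (\<lambda>t. Q (insert t {0, 1}) - p 0 1)"
    by (auto simp: dev_def insert_commute)
  ultimately show ?thesis
    using int by (simp add: U.prob_space)
qed

lemma integrable_dev: "integrable unif dev" "integrable unif (\<lambda>t. (dev t)\<^sup>2)"
proof -
  interpret U: prob_space unif by (rule prob_space_unif)
  show "integrable unif dev"
    by (rule U.integrable_const_bound[where B = 1]) (auto simp: dev_abs_le_1)
  show "integrable unif (\<lambda>t. (dev t)\<^sup>2)"
    by (rule U.integrable_const_bound[where B = 1]) (auto simp: dev_abs_le_1 abs_square_le_1)
qed

text \<open>Any point other than \<open>u i\<close> can be integrated out: \<open>dev (u i)\<close>
  does not involve it, and \<open>Q_insert_average\<close> removes it from \<open>W\<close>. What is
  left is the mean of \<open>(p 0 1 + dev) * dev\<close>, where the linear term vanishes since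
  \<open>dev\<close> has mean zero.\<close>

lemma integral_W_dev:
  assumes "finite I" "i \<notin> I"
  shows "(\<integral>u. W (insert i I) u * dev (u i) \<partial>PiM (insert i I) (\<lambda>_. unif)) = dev_var"
  using assms
proof (induction I)
  case empty
  interpret U: prob_space unif by (rule prob_space_unif)
  have "(\<integral>u. W {i} u * dev (u i) \<partial>PiM {i} (\<lambda>_. unif)) =
     (\<integral>u. (\<lambda>t. Q {0, 1, t} * dev t) (u i) \<partial>PiM {i} (\<lambda>_. unif))"
    by (simp add: W_def insert_commute)
  also have "\<dots> = (\<integral>t. Q {0, 1, t} * dev t \<partial>unif)"
  proof (rule product_sigma_finite.product_integral_singleton[OF product_sigma_finite_unif])
    have "(\<lambda>t. (dev t + p 0 1) * dev t) \<in> borel_measurable unif" by measurable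
    then show "(\<lambda>t. Q {0, 1, t} * dev t) \<in> borel_measurable unif" by (simp add: dev_def)
  qed
  also have "\<dots> = (\<integral>t. (dev t)\<^sup>2 + p 0 1 * dev t \<partial>unif)"
    by (simp add: dev_def power2_eq_square algebra_simps)
  also have "\<dots> = dev_var"
    using integrable_dev by (simp add: dev_var_def integral_dev)
  finally show ?case .
next
  case (insert k I)
  let ?F = "\<lambda>u. W (insert k (insert i I)) u * dev (u i)"
  let ?P = "PiM (insert i I) (\<lambda>_. unif)"
  have k: "k \<notin> insert i I" "finite (insert i I)" using insert by auto
  have [simp]: "finite I" using k(2) by simp
  have mF: "?F \<in> borel_measurable (PiM (insert k (insert i I)) (\<lambda>_. unif))"
    using k(2) by measurable
  have bF: "\<bar>?F u\<bar> \<le> 1" for u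
    using W_abs_le_1[of "insert k (insert i I)" u] dev_abs_le_1[of "u i"]
    by (simp add: abs_mult mult_le_one)
  have upd: "(\<lambda>z. (fst z)(k := snd z)) \<in> measurable (?P \<Otimes>\<^sub>M unif) (PiM (insert k (insert i I)) (\<lambda>_. unif))"
    by (rule measurable_fun_upd[where J = "insert i I"]) auto
  have "integral\<^sup>L (PiM (insert k (insert i I)) (\<lambda>_. unif)) ?F
      = (\<integral>u. (\<integral>t. ?F (u(k := t)) \<partial>unif) \<partial>?P)"
    by (rule integral_PiM_unif_insert[OF k(2,1) mF bF])
  also have "\<dots> = (\<integral>u. W (insert i I) u * dev (u i) \<partial>?P)"
  proof (rule integral_cong_AE)
    \<comment> \<open>Almost every \<open>u\<close> only, since \<open>Q_insert_average\<close>
      requires the remaining points to lie in \<open>[0, 1]\<close>.\<close>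
    show "AE u in ?P. (\<integral>t. ?F (u(k := t)) \<partial>unif) = W (insert i I) u * dev (u i)"
      using AE_PiM_unif[OF k(2)]
    proof eventually_elim
      fix u assume u: "\<forall>j\<in>insert i I. u j \<in> {0..1::real}"
      let ?S = "{0, 1} \<union> u ` insert i I"
      have "W (insert k (insert i I)) (u(k := t)) = Q (insert t ?S)" for t
      proof -
        have "(u(k := t)) ` insert k (insert i I) = insert t (u ` insert i I)"
          using k(1) by auto
        then show ?thesis unfolding W_def by simp
      qed
      moreover have "(u(k := t)) i = u i" for t
        using k(1) by auto
      ultimately have "(\<integral>t. ?F (u(k := t)) \<partial>unif) = (\<integral>t. Q (insert t ?S) \<partial>unif) * dev (u i)"
        by simp
      also have "(\<integral>t. Q (insert t ?S) \<partial>unif) = Q ?S"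
        by (rule Q_insert_average) (use k(2) u in auto)
      finally show "(\<integral>t. ?F (u(k := t)) \<partial>unif) = W (insert i I) u * dev (u i)"
        by (simp add: W_def)
    qed
    interpret sigma_finite_measure unif
      using prob_space_unif by (rule prob_space_imp_sigma_finite)
    have "(\<lambda>z. ?F ((fst z)(k := snd z))) \<in> borel_measurable (?P \<Otimes>\<^sub>M unif)"
      by (rule measurable_compose[OF upd mF])
    then show "(\<lambda>u. \<integral>t. ?F (u(k := t)) \<partial>unif) \<in> borel_measurable ?P"
      by (intro borel_measurable_lebesgue_integral) (simp add: case_prod_beta')
    show "(\<lambda>u. W (insert i I) u * dev (u i)) \<in> borel_measurable ?P"
      using k(2) by measurable
  qed
  also have "\<dots> = dev_var"
    using insert by auto
  finally show ?case
    by (simp add: insert_commute)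
qed

text \<open>Integrating the new coordinate first kills the cross term, because \<open>dev\<close>
  has mean zero; each coordinate therefore adds one \<open>dev_var\<close>.\<close>

lemma integral_sum_dev_sq:
  fixes I :: "nat set"
  assumes "finite I"
  shows "(\<integral>u. (\<Sum>i\<in>I. dev (u i))\<^sup>2 \<partial>PiM I (\<lambda>_. unif)) = card I * dev_var"
  using assms
proof (induction I)
  case empty
  then show ?case by simp
next
  case (insert k I)
  interpret U: prob_space unif by (rule prob_space_unif)
  interpret P: prob_space "PiM I (\<lambda>_. unif) :: (nat \<Rightarrow> real) measure" by (rule prob_space_PiM_unif)
  let ?s = "\<lambda>I u. \<Sum>i\<in>I. dev (u i)"
  have bound: "\<bar>?s J u\<bar> \<le> card J" if "finite J" for J and u :: "nat \<Rightarrow> real"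
    by (rule sum_dev_bound)
  have bound2: "\<bar>(?s J u)\<^sup>2\<bar> \<le> (card J)\<^sup>2" if "finite J" for J and u :: "nat \<Rightarrow> real"
    using power_mono[OF bound[OF that, of u] abs_ge_zero, of 2] by simp
  have "(\<integral>u. (?s (insert k I) u)\<^sup>2 \<partial>PiM (insert k I) (\<lambda>_. unif))
      = (\<integral>u. (\<integral>t. (?s (insert k I) (u(k := t)))\<^sup>2 \<partial>unif) \<partial>PiM I (\<lambda>_. unif))"
    by (rule integral_PiM_unif_insert[OF insert(1,2) _ bound2]) (use insert(1) in auto)
  also have "\<dots> = (\<integral>u. (?s I u)\<^sup>2 + dev_var \<partial>PiM I (\<lambda>_. unif))"
  proof (rule Bochner_Integration.integral_cong[OF refl])
    fix u :: "nat \<Rightarrow> real"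
    have "(\<Sum>i\<in>I. dev ((u(k := t)) i)) = ?s I u" for t
      using insert(2) by (intro sum.cong) auto
    then have eq: "?s (insert k I) (u(k := t)) = dev t + ?s I u" for t
      using insert by simp
    have "(\<integral>t. (?s (insert k I) (u(k := t)))\<^sup>2 \<partial>unif)
        = (\<integral>t. (?s I u)\<^sup>2 + ((dev t)\<^sup>2 + 2 * ?s I u * dev t) \<partial>unif)"
      unfolding eq by (simp add: power2_sum algebra_simps)
    also have "\<dots> = (?s I u)\<^sup>2 + dev_var"
      using integrable_dev by (simp add: U.prob_space integral_dev dev_var_def)
    finally show "(\<integral>t. (?s (insert k I) (u(k := t)))\<^sup>2 \<partial>unif) = (?s I u)\<^sup>2 + dev_var" .
  qed
  also have "\<dots> = card I * dev_var + dev_var"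
  proof -
    have "integrable (PiM I (\<lambda>_. unif)) (\<lambda>u. (?s I u)\<^sup>2)"
      by (rule integrable_PiM_unif[OF _ bound2]) (use insert(1) in auto)
    then show ?thesis using insert by (simp add: P.prob_space)
  qed
  finally show ?case using insert by (simp add: algebra_simps)
qed

text \<open>Bessel's inequality: the functions \<open>dev (u i)\<close> are orthogonal with squared norm \<open>dev_var\<close>, and
  each of them has inner product \<open>dev_var\<close> with the bounded function \<open>W\<close>.\<close>
lemma dev_var_eq_0: "dev_var = 0"
proof (rule ccontr)
  assume "dev_var \<noteq> 0"
  moreover have "0 \<le> dev_var" unfolding dev_var_def by simp
  ultimately have "0 < dev_var" by simp
  then obtain n :: nat where n: "1 < n * dev_var"
    using reals_Archimedean3 by blast
  define P where "P = PiM {..<n} (\<lambda>_::nat. unif)"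
  interpret P: prob_space P unfolding P_def by (rule prob_space_PiM_unif)
  let ?s = "\<lambda>u. \<Sum>i<n. dev (u i)"
  have mW: "W {..<n} \<in> borel_measurable P" unfolding P_def by measurable
  have md: "(\<lambda>u. dev (u i)) \<in> borel_measurable P" if "i < n" for i
    unfolding P_def by measurable (use that in auto)
  note [measurable] = mW
  have ms [measurable]: "?s \<in> borel_measurable P"
    using md by auto
  have bs: "\<bar>?s u\<bar> \<le> n" for u
    using sum_dev_bound[of u "{..<n}"] by simp
  have iW: "integrable P (\<lambda>u. (W {..<n} u)\<^sup>2)"
    by (rule P.integrable_const_bound[where B = 1]) (auto simp: W_abs_le_1 abs_square_le_1)
  have id: "integrable P (\<lambda>u. W {..<n} u * dev (u i))" if "i < n" for i
    by (rule P.integrable_const_bound[where B = 1])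
      (use W_abs_le_1 dev_abs_le_1 md[OF that] in \<open>auto simp: abs_mult mult_le_one\<close>)
  have isq: "integrable P (\<lambda>u. (?s u)\<^sup>2)"
    by (rule P.integrable_const_bound[where B = "n\<^sup>2"])
      (use power_mono[OF bs abs_ge_zero, where n = 2] in auto)
  have "(\<integral>u. W {..<n} u * dev (u i) \<partial>P) = dev_var" if "i < n" for i
  proof -
    have "insert i ({..<n} - {i}) = {..<n}" using that by auto
    then show ?thesis
      using integral_W_dev[of "{..<n} - {i}" i] unfolding P_def by simp
  qed
  then have 1: "(\<integral>u. (\<Sum>i<n. W {..<n} u * dev (u i)) \<partial>P) = n * dev_var"
    using id by (subst Bochner_Integration.integral_sum) auto
  have 2: "(\<integral>u. (?s u)\<^sup>2 \<partial>P) = n * dev_var"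
    using integral_sum_dev_sq[of "{..<n}"] unfolding P_def by simp
  have 3: "(\<integral>u. (W {..<n} u)\<^sup>2 \<partial>P) \<le> 1"
    by (rule P.integral_le_const[OF iW]) (auto simp: W_abs_le_1 abs_square_le_1)
  \<comment> \<open>Subtracting the deviations with coefficient 1 is the orthogonal projection: the
    inner product of \<open>W\<close> with each of them equals its squared norm. Expanding leaves
    \<open>n * dev_var \<le> 1\<close>, against the choice of \<open>n\<close>.\<close>
  have "0 \<le> (\<integral>u. (W {..<n} u - ?s u)\<^sup>2 \<partial>P)" by simp
  also have "\<dots> = (\<integral>u. (W {..<n} u)\<^sup>2 + (?s u)\<^sup>2 - 2 * (\<Sum>i<n. W {..<n} u * dev (u i)) \<partial>P)"
    by (simp add: power2_diff sum_distrib_left mult.assoc)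
  also have "\<dots> = (\<integral>u. (W {..<n} u)\<^sup>2 \<partial>P) + n * dev_var - 2 * (n * dev_var)"
  proof -
    have "integrable P (\<lambda>u. \<Sum>i<n. W {..<n} u * dev (u i))"
      by (intro Bochner_Integration.integrable_sum id) simp
    then show ?thesis using iW isq by (simp add: 1 2)
  qed
  finally show False using 3 n by linarith
qed

theorem AE_split: "AE t in unif. p 0 t * p t 1 = p 0 1"
proof -
  have "AE t in unif. (dev t)\<^sup>2 = 0"
    using dev_var_eq_0 integral_nonneg_eq_0_iff_AE[OF integrable_dev(2)] unfolding dev_var_def by simp
  moreover note AE_unif_open
  ultimately show ?thesis
  proof eventually_elim
    fix t assume t: "(dev t)\<^sup>2 = 0" "t \<in> {0<..<1}"
    have g: "gaps {0, 1} = {(0, 1)}" by (auto simp: gaps_def)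
    have "Q (insert t {0, 1}) = p 0 t * p t 1"
      using Q_insert[of "{0, 1}" 0 1 t] t(2) g by simp
    then show "p 0 t * p t 1 = p 0 1"
      using t(1) by (simp add: dev_def insert_commute)
  qed
qed

end

section \<open>Independent uniform variables on the binary tree\<close>

text \<open>Binary words as indices make self-similarity immediate: the part of a tree below either
  child of the root is again indexed by all words. The root \<open>[]\<close> carries the height of
  the midpoint 1/2, \<open>False\<close> leads to the left half and \<open>True\<close> to the right
  half.\<close>

definition tree_measure :: "(bool list \<Rightarrow> real) measure" where
  "tree_measure = PiM UNIV (\<lambda>_. unif)"

lemma space_tree_measure [simp]: "space tree_measure = UNIV"
  by (simp add: tree_measure_def space_PiM)

lemma UNIV_in_sets_tree_measure [simp, intro]: "UNIV \<in> sets tree_measure"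
  using sets.top[of tree_measure] by simp

lemma prob_space_tree_measure: "prob_space tree_measure"
  unfolding tree_measure_def by (rule prob_space_PiM_unif)

lemma measurable_tree_component: "(\<lambda>Y. Y s) \<in> measurable tree_measure unif"
  unfolding tree_measure_def by (rule measurable_component_singleton) simp

lemma borel_measurable_tree_component [measurable]: "(\<lambda>Y. Y s) \<in> borel_measurable tree_measure"
  using measurable_tree_component by (simp cong: measurable_cong_sets)

lemma measurable_tree_measureI:
  assumes "\<And>s. (\<lambda>w. f w s) \<in> borel_measurable N"
  shows "f \<in> measurable N tree_measure"
proof -
  have "(\<lambda>w. f w s) \<in> measurable N unif" for s
    using assms by (simp cong: measurable_cong_sets)
  then show ?thesis
    unfolding tree_measure_def by (intro measurable_PiM_single') (auto simp: space_PiM)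
qed

definition subtree :: "bool \<Rightarrow> (bool list \<Rightarrow> real) \<Rightarrow> bool list \<Rightarrow> real" where
  "subtree b Y = (\<lambda>s. Y (b # s))"

lemma measurable_subtree [measurable]: "subtree b \<in> measurable tree_measure tree_measure"
  unfolding subtree_def by (rule measurable_tree_measureI) measurable

text \<open>The inverse of cutting a tree into its root value and its two subtrees.\<close>

fun graft :: "real \<times> (bool list \<Rightarrow> real) \<times> (bool list \<Rightarrow> real) \<Rightarrow> bool list \<Rightarrow> real" where
  "graft (t, l, r) [] = t"
| "graft (t, l, r) (b # s) = (if b then r s else l s)"

lemma subtree_graft [simp]: "subtree False (graft (t, l, r)) = l" "subtree True (graft (t, l, r)) = r"
  by (auto simp: subtree_def)

lemma measurable_graft [measurable]: "graft \<in> measurable (unif \<Otimes>\<^sub>M (tree_measure \<Otimes>\<^sub>M tree_measure)) tree_measure"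
proof (rule measurable_tree_measureI)
  fix s
  show "(\<lambda>w. graft w s) \<in> borel_measurable (unif \<Otimes>\<^sub>M (tree_measure \<Otimes>\<^sub>M tree_measure))"
  proof (cases s)
    case Nil
    then have "(\<lambda>w. graft w s) = fst" by (auto simp: fun_eq_iff)
    then show ?thesis by simp
  next
    case (Cons b s')
    show ?thesis
    proof (cases b)
      case True
      then have "(\<lambda>w. graft w s) = (\<lambda>w. snd (snd w) s')"
        using Cons by (auto simp: fun_eq_iff)
      then show ?thesis by simp
    next
      case False
      then have "(\<lambda>w. graft w s) = (\<lambda>w. fst (snd w) s')"
        using Cons by (auto simp: fun_eq_iff)
      then show ?thesis by simp
    qed
  qed
qed

section \<open>Cylinders and self-similarity of the product measure\<close>

text \<open>The constraints form a total family, equal to \<open>UNIV\<close> off a finite set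
  whenever it matters. Passing to a subtree is then the plain shift from \<open>F s\<close> to
  \<open>F (b # s)\<close>.\<close>

definition cylinder :: "(bool list \<Rightarrow> real set) \<Rightarrow> (bool list \<Rightarrow> real) set" where
  "cylinder F = {Y. \<forall>s. Y s \<in> F s}"

lemma prod_emb_eq_cylinder:
  "prod_emb UNIV (\<lambda>_. unif) J (Pi\<^sub>E J F) = cylinder (\<lambda>s. if s \<in> J then F s else UNIV)"
  by (auto simp: prod_emb_def cylinder_def space_PiM PiE_iff extensional_def restrict_def)

lemma cylinder_eq_prod_emb:
  assumes "\<And>s. s \<notin> J \<Longrightarrow> F s = UNIV"
  shows "cylinder F = prod_emb UNIV (\<lambda>_. unif) J (Pi\<^sub>E J F)"
  unfolding prod_emb_eq_cylinder using assms by (auto simp: cylinder_def)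

lemma emeasure_cylinder:
  assumes "finite J" "\<And>s. s \<notin> J \<Longrightarrow> F s = UNIV" "\<And>s. F s \<in> sets borel"
  shows "emeasure tree_measure (cylinder F) = (\<Prod>s\<in>J. emeasure unif (F s))"
proof -
  have "cylinder F = prod_emb UNIV (\<lambda>_. unif) J (Pi\<^sub>E J F)"
    by (rule cylinder_eq_prod_emb) (rule assms(2))
  then show ?thesis
    unfolding tree_measure_def using assms(1,3) emeasure_PiM_emb[of UNIV "\<lambda>_. unif" J F]
    by (simp add: prob_space_unif)
qed

lemma sets_cylinder:
  assumes "finite J" "\<And>s. s \<notin> J \<Longrightarrow> F s = UNIV" "\<And>s. F s \<in> sets borel"
  shows "cylinder F \<in> sets tree_measure"
proof -
  have "cylinder F = prod_emb UNIV (\<lambda>_. unif) J (Pi\<^sub>E J F)"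
    by (rule cylinder_eq_prod_emb) (rule assms(2))
  then show ?thesis
    unfolding tree_measure_def using assms(1,3) by (simp add: sets_PiM_I)
qed

lemma graft_in_cylinder_iff:
  "graft (t, l, r) \<in> cylinder F \<longleftrightarrow>
    t \<in> F [] \<and> l \<in> cylinder (\<lambda>s. F (False # s)) \<and> r \<in> cylinder (\<lambda>s. F (True # s))"
proof
  assume *: "graft (t, l, r) \<in> cylinder F"
  have "graft (t, l, r) s \<in> F s" for s using * by (simp add: cylinder_def)
  from this[of "[]"] this[of "False # _"] this[of "True # _"]
  show "t \<in> F [] \<and> l \<in> cylinder (\<lambda>s. F (False # s)) \<and> r \<in> cylinder (\<lambda>s. F (True # s))"
    by (simp add: cylinder_def)
next
  assume *: "t \<in> F [] \<and> l \<in> cylinder (\<lambda>s. F (False # s)) \<and> r \<in> cylinder (\<lambda>s. F (True # s))"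
  have "graft (t, l, r) s \<in> F s" for s
  proof (cases s)
    case (Cons b s')
    then show ?thesis using * by (cases b) (auto simp: cylinder_def)
  qed (use * in auto)
  then show "graft (t, l, r) \<in> cylinder F" by (simp add: cylinder_def)
qed

lemma emeasure_cylinder_split:
  assumes J: "finite J" "\<And>s. s \<notin> J \<Longrightarrow> F s = UNIV" and F: "\<And>s. F s \<in> sets borel"
  shows "emeasure tree_measure (cylinder F) = emeasure unif (F []) *
    (emeasure tree_measure (cylinder (\<lambda>s. F (False # s))) * emeasure tree_measure (cylinder (\<lambda>s. F (True # s))))"
proof -
  define K where "K b = {s. b # s \<in> J}" for b
  have K: "finite (K b)" for b
    unfolding K_def using finite_vimageI[OF J(1), of "(#) b"] by (simp add: vimage_def)
  \<comment> \<open>The root is included even if it is not in \<open>J\<close>, so that its factor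
    can be split off; in that case \<open>F []\<close> is \<open>UNIV\<close> and the factor is
    1.\<close>
  let ?J = "insert [] ((#) False ` K False \<union> (#) True ` K True)"
  have J': "F s = UNIV" if "s \<notin> ?J" for s
  proof (rule J(2))
    show "s \<notin> J"
    proof
      assume "s \<in> J"
      then have "s \<in> ?J"
      proof (cases s)
        case (Cons b s')
        then show ?thesis using \<open>s \<in> J\<close> by (cases b) (auto simp: K_def)
      qed auto
      then show False using that by contradiction
    qed
  qed
  have "emeasure tree_measure (cylinder F) = (\<Prod>s\<in>?J. emeasure unif (F s))"
    using K J' F by (intro emeasure_cylinder) auto
  also have "\<dots> = emeasure unif (F []) *
      ((\<Prod>s\<in>(#) False ` K False. emeasure unif (F s)) * (\<Prod>s\<in>(#) True ` K True. emeasure unif (F s)))"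
    using K by (subst prod.insert) (auto intro!: prod.union_disjoint arg_cong2[where f = "(*)"])
  finally have *: "emeasure tree_measure (cylinder F) = emeasure unif (F []) *
      ((\<Prod>s\<in>(#) False ` K False. emeasure unif (F s)) * (\<Prod>s\<in>(#) True ` K True. emeasure unif (F s)))" .
  have "(\<Prod>s\<in>(#) b ` K b. emeasure unif (F s)) = emeasure tree_measure (cylinder (\<lambda>s. F (b # s)))" for b
  proof -
    have "(\<Prod>s\<in>(#) b ` K b. emeasure unif (F s)) = (\<Prod>s\<in>K b. emeasure unif (F (b # s)))"
      by (subst prod.reindex) auto
    also have "\<dots> = emeasure tree_measure (cylinder (\<lambda>s. F (b # s)))"
      using K F J(2) by (intro emeasure_cylinder[symmetric]) (auto simp: K_def)
    finally show ?thesis .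
  qed
  then show ?thesis using * by simp
qed

text \<open>Cylinders over finite sets determine the measure, and grafting pulls a cylinder back to
  a rectangle. In probabilistic terms, the root and the two subtrees are independent, and each
  subtree is distributed like the whole tree.\<close>

lemma distr_graft: "distr (unif \<Otimes>\<^sub>M (tree_measure \<Otimes>\<^sub>M tree_measure)) tree_measure graft = tree_measure"
proof -
  interpret T: prob_space tree_measure by (rule prob_space_tree_measure)
  interpret TT: pair_prob_space tree_measure tree_measure by unfold_locales
  interpret U: prob_space unif by (rule prob_space_unif)
  have "tree_measure = distr (unif \<Otimes>\<^sub>M (tree_measure \<Otimes>\<^sub>M tree_measure)) tree_measure graft"
  proof (rule measure_eqI_PiM_infinite[where I = UNIV and M = "\<lambda>_. unif"])
    show "sets tree_measure = sets (PiM UNIV (\<lambda>_. unif))"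
      "sets (distr (unif \<Otimes>\<^sub>M (tree_measure \<Otimes>\<^sub>M tree_measure)) tree_measure graft) = sets (PiM UNIV (\<lambda>_. unif))"
      by (simp_all add: tree_measure_def)
    show "finite_measure tree_measure" by (rule T.finite_measure_axioms)
    fix A :: "bool list \<Rightarrow> real set" and J assume J: "finite J" "\<And>i. i \<in> J \<Longrightarrow> A i \<in> sets unif"
    define F where "F s = (if s \<in> J then A s else UNIV)" for s
    have F: "F s = UNIV" if "s \<notin> J" for s using that by (simp add: F_def)
    have F': "F s \<in> sets borel" for s using J by (simp add: F_def)
    have b [measurable]: "cylinder (\<lambda>s. F (c # s)) \<in> sets tree_measure" for c
    proof (rule sets_cylinder)
      show "finite ((#) c -` J)" using J(1) by (rule finite_vimageI) auto
    qed (auto simp: F F')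
    have "graft -` cylinder F \<inter> space (unif \<Otimes>\<^sub>M (tree_measure \<Otimes>\<^sub>M tree_measure))
        = F [] \<times> (cylinder (\<lambda>s. F (False # s)) \<times> cylinder (\<lambda>s. F (True # s)))"
      by (auto simp: graft_in_cylinder_iff space_pair_measure)
    then have "emeasure (distr (unif \<Otimes>\<^sub>M (tree_measure \<Otimes>\<^sub>M tree_measure)) tree_measure graft) (cylinder F)
       = emeasure (unif \<Otimes>\<^sub>M (tree_measure \<Otimes>\<^sub>M tree_measure)) (F [] \<times> (cylinder (\<lambda>s. F (False # s)) \<times> cylinder (\<lambda>s. F (True # s))))"
      by (subst emeasure_distr) (auto intro!: sets_cylinder[OF J(1)] F F')
    also have "\<dots> = emeasure unif (F []) *
       (emeasure tree_measure (cylinder (\<lambda>s. F (False # s))) * emeasure tree_measure (cylinder (\<lambda>s. F (True # s))))"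
      using F' by (subst TT.emeasure_pair_measure_Times) (auto simp: T.emeasure_pair_measure_Times)
    also have "\<dots> = emeasure tree_measure (cylinder F)"
      by (rule emeasure_cylinder_split[OF J(1) _ F', symmetric]) (rule F)
    finally show "emeasure tree_measure (prod_emb UNIV (\<lambda>_. unif) J (Pi\<^sub>E J A)) =
      emeasure (distr (unif \<Otimes>\<^sub>M (tree_measure \<Otimes>\<^sub>M tree_measure)) tree_measure graft) (prod_emb UNIV (\<lambda>_. unif) J (Pi\<^sub>E J A))"
      unfolding prod_emb_eq_cylinder F_def by simp
  qed
  then show ?thesis by simp
qed

text \<open>Conditioning on the root: by Fubini, the section of \<open>S\<close> at root value
  \<open>t\<close> is empty or a rectangle in the two independent subtrees. The sides may depend on
  \<open>t\<close>, as the height at which the halves meet does.\<close>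

lemma measure_tree_split:
  assumes S: "S \<in> sets tree_measure" and A: "A \<in> sets borel"
    and L: "\<And>t. L t \<in> sets tree_measure" "(\<lambda>t. measure tree_measure (L t)) \<in> borel_measurable borel"
    and R: "\<And>t. R t \<in> sets tree_measure" "(\<lambda>t. measure tree_measure (R t)) \<in> borel_measurable borel"
    and split: "\<And>t l r. graft (t, l, r) \<in> S \<longleftrightarrow> t \<in> A \<and> l \<in> L t \<and> r \<in> R t"
  shows "measure tree_measure S = (\<integral>t. indicator A t * (measure tree_measure (L t) * measure tree_measure (R t)) \<partial>unif)"
proof -
  interpret T: prob_space tree_measure by (rule prob_space_tree_measure)
  interpret TT: pair_prob_space tree_measure tree_measure by unfold_locales
  interpret U: prob_space unif by (rule prob_space_unif)
  let ?f = "\<lambda>t. indicator A t * (measure tree_measure (L t) * measure tree_measure (R t))"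
  have "emeasure tree_measure S = emeasure (distr (unif \<Otimes>\<^sub>M (tree_measure \<Otimes>\<^sub>M tree_measure)) tree_measure graft) S"
    by (simp add: distr_graft)
  also have "\<dots> = emeasure (unif \<Otimes>\<^sub>M (tree_measure \<Otimes>\<^sub>M tree_measure)) (graft -` S \<inter> space (unif \<Otimes>\<^sub>M (tree_measure \<Otimes>\<^sub>M tree_measure)))"
    by (rule emeasure_distr) (auto simp: S)
  also have "\<dots> = (\<integral>\<^sup>+t. emeasure (tree_measure \<Otimes>\<^sub>M tree_measure)
      (Pair t -` (graft -` S \<inter> space (unif \<Otimes>\<^sub>M (tree_measure \<Otimes>\<^sub>M tree_measure)))) \<partial>unif)"
    by (rule TT.emeasure_pair_measure_alt) (rule measurable_sets[OF measurable_graft S])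
  also have "\<dots> = (\<integral>\<^sup>+t. ennreal (?f t) \<partial>unif)"
  proof (rule nn_integral_cong)
    fix t
    have "Pair t -` (graft -` S \<inter> space (unif \<Otimes>\<^sub>M (tree_measure \<Otimes>\<^sub>M tree_measure)))
        = (if t \<in> A then L t \<times> R t else {})"
      by (auto simp: split space_pair_measure)
    then show "emeasure (tree_measure \<Otimes>\<^sub>M tree_measure) (Pair t -` (graft -` S \<inter> space (unif \<Otimes>\<^sub>M (tree_measure \<Otimes>\<^sub>M tree_measure))))
        = ennreal (?f t)"
      by (simp add: T.emeasure_pair_measure_Times L R T.emeasure_eq_measure ennreal_mult)
  qed
  also have "\<dots> = ennreal (\<integral>t. ?f t \<partial>unif)"
  proof (rule nn_integral_eq_integral)
    have [measurable]: "(\<lambda>t. measure tree_measure (L t)) \<in> borel_measurable unif"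
      "(\<lambda>t. measure tree_measure (R t)) \<in> borel_measurable unif" "A \<in> sets unif"
      using A L(2) R(2) by (simp_all cong: measurable_cong_sets)
    show "integrable unif ?f"
      by (intro U.integrable_const_bound[where B = 1])
        (auto simp: abs_mult mult_le_one split: split_indicator)
  qed auto
  finally show ?thesis
    by (simp add: T.emeasure_eq_measure integral_nonneg_AE)
qed

section \<open>A zero-one law for events that split at the root\<close>

text \<open>Two events are instances: that the stretched function has the interval property, and
  that the tree yields a homeomorphism. Joint measurability in endpoints and tree is demanded
  because after one split the endpoints depend on the root value.\<close>

locale split_event =
  fixes E :: "real \<Rightarrow> real \<Rightarrow> (bool list \<Rightarrow> real) set"
  assumes measurable_event:
      "{w \<in> space ((borel \<Otimes>\<^sub>M borel) \<Otimes>\<^sub>M tree_measure). snd w \<in> E (fst (fst w)) (snd (fst w))}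
        \<in> sets ((borel \<Otimes>\<^sub>M borel) \<Otimes>\<^sub>M tree_measure)"
    and split: "Y \<in> E x y \<longleftrightarrow> Y [] \<in> {0<..<1} \<and> subtree False Y \<in> E x (x + Y [] * (y - x)) \<and>
      subtree True Y \<in> E (x + Y [] * (y - x)) y"
begin

lemma sets_event [measurable]: "E x y \<in> sets tree_measure"
proof -
  have "Pair (x, y) -` {w \<in> space ((borel \<Otimes>\<^sub>M borel) \<Otimes>\<^sub>M tree_measure). snd w \<in> E (fst (fst w)) (snd (fst w))}
      \<in> sets tree_measure"
    by (rule sets_Pair1[OF measurable_event])
  then show ?thesis by (simp add: space_pair_measure)
qed

definition p :: "real \<Rightarrow> real \<Rightarrow> real" where
  "p x y = measure tree_measure (E x y)"

lemma measurable_measure_event: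
  assumes B: "B \<in> sets tree_measure"
  shows "(\<lambda>z. measure tree_measure (E (fst z) (snd z) \<inter> B)) \<in> borel_measurable (borel \<Otimes>\<^sub>M borel)"
proof -
  interpret T: prob_space tree_measure by (rule prob_space_tree_measure)
  let ?M = "(borel \<Otimes>\<^sub>M borel) \<Otimes>\<^sub>M tree_measure :: ((real \<times> real) \<times> (bool list \<Rightarrow> real)) measure"
  show ?thesis
  proof (rule T.measurable_measure)
    have "{w \<in> space ?M. snd w \<in> E (fst (fst w)) (snd (fst w)) \<inter> B}
        = {w \<in> space ?M. snd w \<in> E (fst (fst w)) (snd (fst w))} \<inter> (snd -` B \<inter> space ?M)"
      by auto
    then show "{w \<in> space ?M. snd w \<in> E (fst (fst w)) (snd (fst w)) \<inter> B} \<in> sets ?M"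
      using measurable_event measurable_sets[OF measurable_snd B] by auto
  qed auto
qed

lemma measurable_measure_event':
  assumes "B \<in> sets tree_measure" "u \<in> borel_measurable borel" "v \<in> borel_measurable borel"
  shows "(\<lambda>t. measure tree_measure (E (u t) (v t) \<inter> B)) \<in> borel_measurable borel"
  using measurable_compose[OF measurable_Pair[OF assms(2,3)] measurable_measure_event[OF assms(1)]]
  by simp

lemma graft_in_event_iff:
  "graft (t, l, r) \<in> E x y \<longleftrightarrow> t \<in> {0<..<1} \<and> l \<in> E x (x + t * (y - x)) \<and> r \<in> E (x + t * (y - x)) y"
  by (subst split) simp

lemma measure_event_cylinder_split:
  assumes C: "C \<in> sets tree_measure" "A \<in> sets borel" "CL \<in> sets tree_measure" "CR \<in> sets tree_measure"
    and graft: "\<And>t l r. graft (t, l, r) \<in> C \<longleftrightarrow> t \<in> A \<and> l \<in> CL \<and> r \<in> CR"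
  shows "measure tree_measure (E x y \<inter> C) =
    (\<integral>t. indicator A t * (measure tree_measure (E x (x + t * (y - x)) \<inter> CL)
      * measure tree_measure (E (x + t * (y - x)) y \<inter> CR)) \<partial>unif)"
proof -
  have meas: "(\<lambda>t. measure tree_measure (E x (x + t * (y - x)) \<inter> CL)) \<in> borel_measurable borel"
    "(\<lambda>t. measure tree_measure (E (x + t * (y - x)) y \<inter> CR)) \<in> borel_measurable borel"
    by (rule measurable_measure_event'; use C in simp)+
  have "measure tree_measure (E x y \<inter> C) =
    (\<integral>t. indicator ({0<..<1} \<inter> A) t * (measure tree_measure (E x (x + t * (y - x)) \<inter> CL)
      * measure tree_measure (E (x + t * (y - x)) y \<inter> CR)) \<partial>unif)"
    using C meas by (intro measure_tree_split) (auto simp: graft_in_event_iff graft)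
  also have "\<dots> = (\<integral>t. indicator A t * (measure tree_measure (E x (x + t * (y - x)) \<inter> CL)
      * measure tree_measure (E (x + t * (y - x)) y \<inter> CR)) \<partial>unif)"
  proof (rule integral_cong_AE)
    show "AE t in unif. indicator ({0<..<1} \<inter> A) t * (measure tree_measure (E x (x + t * (y - x)) \<inter> CL)
      * measure tree_measure (E (x + t * (y - x)) y \<inter> CR)) =
      indicator A t * (measure tree_measure (E x (x + t * (y - x)) \<inter> CL)
      * measure tree_measure (E (x + t * (y - x)) y \<inter> CR))"
      using AE_unif_open by eventually_elim (simp add: indicator_def)
  qed (use C in \<open>auto intro!: borel_measurable_unifI borel_measurable_times borel_measurable_indicator meas\<close>)
  finally show ?thesis .
qed

lemma p_average: "(\<integral>t. p x (x + t * (y - x)) * p (x + t * (y - x)) y \<partial>unif) = p x y"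
  using measure_event_cylinder_split[of UNIV UNIV UNIV UNIV x y]
  by (simp add: p_def UNIV_in_sets_tree_measure)

lemma AE_p_split: "AE t in unif. p x (x + t * (y - x)) * p (x + t * (y - x)) y = p x y"
proof -
  interpret T: prob_space tree_measure by (rule prob_space_tree_measure)
  \<comment> \<open>The affine parametrisation carries 0 and 1 to \<open>x\<close> and
    \<open>y\<close>, in either order and also when they coincide. The averaging identity is
    invariant under it, so the result for the endpoints 0 and 1 applies.\<close>
  define q where "q a b = p (x + a * (y - x)) (x + b * (y - x))" for a b
  interpret split_kernel q
  proof
    have "(\<lambda>z. (x + fst z * (y - x), x + snd z * (y - x))) \<in> measurable (borel \<Otimes>\<^sub>M borel) (borel \<Otimes>\<^sub>M borel)"
      by measurable
    from measurable_compose[OF this measurable_measure_event[of UNIV]]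
    show "(\<lambda>z. q (fst z) (snd z)) \<in> borel_measurable (borel \<Otimes>\<^sub>M borel)"
      by (simp add: q_def p_def UNIV_in_sets_tree_measure)
    show "0 \<le> q a b" "q a b \<le> 1" for a b
      by (simp_all add: q_def p_def)
    show "(\<integral>t. q a (a + t * (b - a)) * q (a + t * (b - a)) b \<partial>unif) = q a b" for a b
    proof -
      have "x + (a + t * (b - a)) * (y - x) =
          (x + a * (y - x)) + t * ((x + b * (y - x)) - (x + a * (y - x)))" for t
        by (simp add: algebra_simps)
      then show ?thesis
        unfolding q_def by (simp only: p_average)
    qed
  qed
  show ?thesis
    using AE_split by (simp add: q_def)
qed

text \<open>Splitting at the root and \<open>AE_p_split\<close> carry independence from the cylinders over the first
  \<open>n\<close> levels to those over the first \<open>n + 1\<close> levels.\<close>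
lemma measure_event_cylinder:
  assumes "\<And>s. F s \<in> sets borel" "\<And>s. n \<le> length s \<Longrightarrow> F s = UNIV"
  shows "measure tree_measure (E x y \<inter> cylinder F) = p x y * measure tree_measure (cylinder F)"
  using assms
proof (induction n arbitrary: F x y)
  case 0
  interpret T: prob_space tree_measure by (rule prob_space_tree_measure)
  have "cylinder F = UNIV" using 0 by (simp add: cylinder_def)
  then show ?case using T.prob_space by (simp add: p_def)
next
  case (Suc n)
  let ?C = "\<lambda>b. cylinder (\<lambda>s. F (b # s))"
  have fin: "finite {s::bool list. length s \<le> m}" for m
    using finite_lists_length_le[of "UNIV :: bool set" m] by simp
  have C: "cylinder F \<in> sets tree_measure" "?C b \<in> sets tree_measure" for b
    by (rule sets_cylinder[OF fin[of "Suc n"]]; use Suc in auto)+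
  have IH: "measure tree_measure (E x y \<inter> ?C b) = p x y * measure tree_measure (?C b)" for x y b
    by (rule Suc.IH) (use Suc.prems in auto)
  have "measure tree_measure (E x y \<inter> cylinder F) =
    (\<integral>t. indicator (F []) t * (measure tree_measure (E x (x + t * (y - x)) \<inter> ?C False)
      * measure tree_measure (E (x + t * (y - x)) y \<inter> ?C True)) \<partial>unif)"
    using Suc.prems C by (intro measure_event_cylinder_split) (auto simp: graft_in_cylinder_iff)
  also have "\<dots> = (\<integral>t. p x y * (indicator (F []) t * (measure tree_measure (?C False) * measure tree_measure (?C True))) \<partial>unif)"
  proof (rule integral_cong_AE)
    show "(\<lambda>t. p x y * (indicator (F []) t * (measure tree_measure (?C False) * measure tree_measure (?C True)))) \<in> borel_measurable unif"
      using Suc.prems by (intro borel_measurable_unifI borel_measurable_times borel_measurable_indicator borel_measurable_const)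
    have "(\<lambda>t. measure tree_measure (E x (x + t * (y - x)) \<inter> ?C False)) \<in> borel_measurable borel"
      "(\<lambda>t. measure tree_measure (E (x + t * (y - x)) y \<inter> ?C True)) \<in> borel_measurable borel"
      by (rule measurable_measure_event'; use C in simp)+
    then show "(\<lambda>t. indicator (F []) t * (measure tree_measure (E x (x + t * (y - x)) \<inter> ?C False)
      * measure tree_measure (E (x + t * (y - x)) y \<inter> ?C True))) \<in> borel_measurable unif"
      using Suc.prems by (intro borel_measurable_unifI borel_measurable_times borel_measurable_indicator)
    show "AE t in unif. indicator (F []) t * (measure tree_measure (E x (x + t * (y - x)) \<inter> ?C False)
        * measure tree_measure (E (x + t * (y - x)) y \<inter> ?C True))
      = p x y * (indicator (F []) t * (measure tree_measure (?C False) * measure tree_measure (?C True)))"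
      using AE_p_split[of x y]
    proof eventually_elim
      fix t assume t: "p x (x + t * (y - x)) * p (x + t * (y - x)) y = p x y"
      show "indicator (F []) t * (measure tree_measure (E x (x + t * (y - x)) \<inter> ?C False)
        * measure tree_measure (E (x + t * (y - x)) y \<inter> ?C True))
      = p x y * (indicator (F []) t * (measure tree_measure (?C False) * measure tree_measure (?C True)))"
        unfolding IH t[symmetric] by (simp add: mult_ac)
    qed
  qed
  also have "\<dots> = p x y * (\<integral>t. indicator (F []) t * (measure tree_measure (?C False) * measure tree_measure (?C True)) \<partial>unif)"
    by simp
  also have "(\<integral>t. indicator (F []) t * (measure tree_measure (?C False) * measure tree_measure (?C True)) \<partial>unif)
      = measure tree_measure (cylinder F)"
    using Suc.prems C by (intro measure_tree_split[symmetric]) (auto simp: graft_in_cylinder_iff)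
  finally show ?case .
qed

text \<open>The restriction of the measure to \<open>E x y\<close> and its multiple by
  \<open>p x y\<close> agree on cylinders, hence on all measurable sets. Evaluated at
  \<open>E x y\<close> itself they give \<open>p x y = p x y * p x y\<close>.\<close>

theorem measure_event_zero_one: "measure tree_measure (E x y) \<in> {0, 1}"
proof -
  interpret T: prob_space tree_measure by (rule prob_space_tree_measure)
  have "density tree_measure (indicator (E x y)) = density tree_measure (\<lambda>_. ennreal (p x y))"
  proof (rule measure_eqI_PiM_infinite[where I = UNIV and M = "\<lambda>_. unif"])
    show "sets (density tree_measure (indicator (E x y))) = sets (PiM UNIV (\<lambda>_. unif))"
      "sets (density tree_measure (\<lambda>_. ennreal (p x y))) = sets (PiM UNIV (\<lambda>_. unif))"
      by (simp_all add: tree_measure_def)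
    show "finite_measure (density tree_measure (indicator (E x y)))"
      by (rule finite_measureI) (simp add: emeasure_density T.emeasure_eq_measure)
    fix A :: "bool list \<Rightarrow> real set" and J assume J: "finite J" "\<And>i. i \<in> J \<Longrightarrow> A i \<in> sets unif"
    define F where "F s = (if s \<in> J then A s else UNIV)" for s
    have F: "F s = UNIV" if "s \<notin> J" for s using that by (simp add: F_def)
    have F': "F s \<in> sets borel" for s using J by (simp add: F_def)
    have C [measurable]: "cylinder F \<in> sets tree_measure"
      by (rule sets_cylinder[OF J(1)]) (auto simp: F F')
    have "measure tree_measure (E x y \<inter> cylinder F) = p x y * measure tree_measure (cylinder F)"
    proof (rule measure_event_cylinder)
      fix s :: "bool list"
      \<comment> \<open>One level below the deepest word of \<open>J\<close>; the inserted 0 covers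
        the case of empty \<open>J\<close>.\<close>
      assume "Suc (Max (insert 0 (length ` J))) \<le> length s"
      have "length s \<le> Max (insert 0 (length ` J))" if "s \<in> J"
        using J(1) that by (intro Max_ge) auto
      with \<open>Suc (Max (insert 0 (length ` J))) \<le> length s\<close> have "s \<notin> J" by linarith
      then show "F s = UNIV" by (rule F)
    qed (rule F')
    then have "emeasure (density tree_measure (indicator (E x y))) (cylinder F) =
        emeasure (density tree_measure (\<lambda>_. ennreal (p x y))) (cylinder F)"
      by (simp add: emeasure_density T.emeasure_eq_measure ennreal_mult' p_def nn_integral_cmult
          flip: indicator_inter_arith)
    then show "emeasure (density tree_measure (indicator (E x y))) (prod_emb UNIV (\<lambda>_. unif) J (Pi\<^sub>E J A)) =
      emeasure (density tree_measure (\<lambda>_. ennreal (p x y))) (prod_emb UNIV (\<lambda>_. unif) J (Pi\<^sub>E J A))"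
      unfolding prod_emb_eq_cylinder F_def .
  qed
  then have "emeasure (density tree_measure (indicator (E x y))) (E x y)
     = emeasure (density tree_measure (\<lambda>_. ennreal (p x y))) (E x y)"
    by simp
  then have "ennreal (p x y) = ennreal (p x y * p x y)"
    by (simp add: emeasure_density T.emeasure_eq_measure ennreal_mult' p_def nn_integral_cmult
        flip: indicator_inter_arith)
  then have "p x y = p x y * p x y"
    by (simp add: p_def)
  then show ?thesis
    by (auto simp: p_def)
qed

end

section \<open>The random homeomorphism on the tree\<close>

text \<open>On \<open>[0, 1]\<close> this is the piecewise linear interpolation of the dyadic values
  of level \<open>n\<close>. Clamping with \<open>min\<close> and \<open>max\<close> freezes the
  half that does not contain \<open>s\<close> at an endpoint value, so one formula without case
  distinction serves both halves and is visibly continuous.\<close>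

primrec approx :: "nat \<Rightarrow> (bool list \<Rightarrow> real) \<Rightarrow> real \<Rightarrow> real" where
  "approx 0 Y s = s"
| "approx (Suc n) Y s = Y [] * approx n (subtree False Y) (min 1 (2 * s))
    + (1 - Y []) * approx n (subtree True Y) (max 0 (2 * s - 1))"

text \<open>For node values in \<open>(0, 1)\<close> this is the largest increment of
  \<open>approx n Y\<close> over a dyadic interval of length \<open>1 / 2 ^ n\<close>.\<close>

primrec mesh :: "nat \<Rightarrow> (bool list \<Rightarrow> real) \<Rightarrow> real" where
  "mesh 0 Y = 1"
| "mesh (Suc n) Y = max (Y [] * mesh n (subtree False Y)) ((1 - Y []) * mesh n (subtree True Y))"

text \<open>A measurable criterion for the dyadic values to extend to a homeomorphism:
  \<open>dyadic_homeo_phi\<close> and \<open>dyadic_homeo_imp_good\<close> give the two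
  directions.\<close>

definition good :: "(bool list \<Rightarrow> real) \<Rightarrow> bool" where
  "good Y \<longleftrightarrow> (\<forall>s. Y s \<in> {0<..<1}) \<and> (\<lambda>n. mesh n Y) \<longlonglongrightarrow> 0"

definition phi :: "(bool list \<Rightarrow> real) \<Rightarrow> real \<Rightarrow> real" where
  "phi Y s = lim (\<lambda>n. approx n Y s)"

lemma approx_0 [simp]: "approx n Y 0 = 0"
  by (induction n arbitrary: Y) auto

lemma approx_1 [simp]: "approx n Y 1 = 1"
  by (induction n arbitrary: Y) auto

lemma approx_left: "s \<le> 1/2 \<Longrightarrow> approx (Suc n) Y s = Y [] * approx n (subtree False Y) (2 * s)"
  by (auto simp: min_def max_def field_simps)

lemma approx_right:
  "1/2 \<le> s \<Longrightarrow> approx (Suc n) Y s = Y [] + (1 - Y []) * approx n (subtree True Y) (2 * s - 1)"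
  by (auto simp: min_def max_def field_simps)

lemma subtree_in_open: "(\<And>s. Y s \<in> {0<..<1}) \<Longrightarrow> subtree b Y s \<in> {0<..<1}"
  by (simp add: subtree_def)

lemma mesh_nonneg: "(\<And>s. Y s \<in> {0<..<1}) \<Longrightarrow> 0 \<le> mesh n Y"
proof (induction n arbitrary: Y)
  case (Suc n)
  have "0 \<le> mesh n (subtree b Y)" for b
    using Suc.prems by (intro Suc.IH subtree_in_open) auto
  moreover have "0 < Y []" using Suc.prems[of "[]"] by simp
  ultimately show ?case by (simp add: le_max_iff_disj)
qed simp

lemma approx_mono:
  assumes "\<And>s. Y s \<in> {0<..<1}" "0 \<le> s" "s \<le> s'" "s' \<le> 1"
  shows "approx n Y s \<le> approx n Y s'"
  using assms
proof (induction n arbitrary: Y s s')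
  case (Suc n)
  have "0 < Y []" "Y [] < 1" using Suc.prems(1)[of "[]"] by auto
  moreover have "approx n (subtree b Y) u \<le> approx n (subtree b Y) u'" if "0 \<le> u" "u \<le> u'" "u' \<le> 1" for b u u'
    using Suc.prems(1) that by (intro Suc.IH subtree_in_open) auto
  ultimately show ?case
    using Suc.prems(2-) unfolding approx.simps
    by (intro add_mono mult_left_mono) auto
qed simp

lemma approx_range:
  assumes "\<And>s. Y s \<in> {0<..<1}" "s \<in> {0..1}"
  shows "approx n Y s \<in> {0..1}"
  using approx_mono[of Y 0 s n] approx_mono[of Y s 1 n] assms by auto

text \<open>On a dyadic interval of level \<open>n\<close> both functions lie between the same two
  endpoint values, which later refinements leave unchanged.\<close>

lemma approx_diff_le_mesh:
  assumes "\<And>s. Y s \<in> {0<..<1}" "s \<in> {0..1}" "n \<le> m"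
  shows "\<bar>approx m Y s - approx n Y s\<bar> \<le> mesh n Y"
  using assms
proof (induction n arbitrary: Y s m)
  case 0
  then show ?case using approx_range[of Y s m] by (auto simp: abs_le_iff)
next
  case (Suc n)
  then obtain k where m: "m = Suc k" "n \<le> k" by (cases m) auto
  have Y: "0 < Y []" "Y [] < 1" using Suc.prems(1)[of "[]"] by auto
  have IH: "\<bar>approx k (subtree b Y) u - approx n (subtree b Y) u\<bar> \<le> mesh n (subtree b Y)" if "u \<in> {0..1}" for b u
    using Suc.prems(1) that m(2) by (intro Suc.IH subtree_in_open) auto
  show ?case
  proof (cases "s \<le> 1/2")
    case True
    then have "\<bar>approx m Y s - approx (Suc n) Y s\<bar>
        = Y [] * \<bar>approx k (subtree False Y) (2 * s) - approx n (subtree False Y) (2 * s)\<bar>"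
      unfolding m(1) approx_left[OF True] using Y by (simp add: abs_mult flip: right_diff_distrib)
    also have "\<dots> \<le> Y [] * mesh n (subtree False Y)"
      using Y Suc.prems(2) True by (intro mult_left_mono IH) auto
    finally show ?thesis by simp
  next
    case False
    then have s: "1/2 \<le> s" by simp
    have "\<bar>approx m Y s - approx (Suc n) Y s\<bar>
        = (1 - Y []) * \<bar>approx k (subtree True Y) (2 * s - 1) - approx n (subtree True Y) (2 * s - 1)\<bar>"
      unfolding m(1) approx_right[OF s] using Y by (simp add: abs_mult flip: right_diff_distrib)
    also have "\<dots> \<le> (1 - Y []) * mesh n (subtree True Y)"
      using Y Suc.prems(2) s by (intro mult_left_mono IH) auto
    finally show ?thesis by simp
  qed
qed

text \<open>The mesh is the maximum of the two subtree meshes with the weights \<open>Y []\<close>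
  and \<open>1 - Y []\<close>. As both weights are positive, it tends to 0 exactly when both subtree
  meshes do.\<close>

lemma good_iff: "good Y \<longleftrightarrow> Y [] \<in> {0<..<1} \<and> good (subtree False Y) \<and> good (subtree True Y)"
proof
  assume g: "good Y"
  then have Y: "\<And>s. Y s \<in> {0<..<1}" and m: "(\<lambda>n. mesh n Y) \<longlonglongrightarrow> 0" by (auto simp: good_def)
  have sub: "0 \<le> mesh n (subtree b Y)" for b n
    by (intro mesh_nonneg subtree_in_open Y)
  have zero: "g \<longlonglongrightarrow> 0" if "0 < c" "\<And>n. 0 \<le> g n" "\<And>n. c * g n \<le> mesh (Suc n) Y" for c and g :: "nat \<Rightarrow> real"
  proof (rule real_tendsto_sandwich[OF _ _ tendsto_const])
    show "(\<lambda>n. mesh (Suc n) Y / c) \<longlonglongrightarrow> 0"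
      using tendsto_divide[OF LIMSEQ_Suc[OF m] tendsto_const[of c]] that(1) by simp
  qed (use that in \<open>auto simp: field_simps\<close>)
  have "(\<lambda>n. mesh n (subtree False Y)) \<longlonglongrightarrow> 0" "(\<lambda>n. mesh n (subtree True Y)) \<longlonglongrightarrow> 0"
    using Y[of "[]"] sub
    by (auto intro!: zero[of "Y []" "\<lambda>n. mesh n (subtree False Y)"] zero[of "1 - Y []" "\<lambda>n. mesh n (subtree True Y)"])
  then show "Y [] \<in> {0<..<1} \<and> good (subtree False Y) \<and> good (subtree True Y)"
    using Y subtree_in_open[of Y] by (simp add: good_def)
next
  assume *: "Y [] \<in> {0<..<1} \<and> good (subtree False Y) \<and> good (subtree True Y)"
  have "Y s \<in> {0<..<1}" for s
  proof (cases s)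
    case (Cons b s')
    have "good (subtree b Y)"
      using * by (cases b) simp_all
    then have "subtree b Y s' \<in> {0<..<1}"
      unfolding good_def by blast
    then show ?thesis using Cons by (simp add: subtree_def)
  qed (use * in simp)
  moreover have "(\<lambda>n. mesh n Y) \<longlonglongrightarrow> 0"
  proof (rule LIMSEQ_imp_Suc)
    have "(\<lambda>n. max (Y [] * mesh n (subtree False Y)) ((1 - Y []) * mesh n (subtree True Y))) \<longlonglongrightarrow> max (Y [] * 0) ((1 - Y []) * 0)"
      using * unfolding good_def by (intro tendsto_intros) auto
    then show "(\<lambda>n. mesh (Suc n) Y) \<longlonglongrightarrow> 0" by simp
  qed
  ultimately show "good Y" by (simp add: good_def)
qed

lemma good_subtree: "good Y \<Longrightarrow> good (subtree b Y)"
  using good_iff[of Y] by (cases b) simp_all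

lemma good_root: "good Y \<Longrightarrow> 0 < Y []" "good Y \<Longrightarrow> Y [] < 1"
  using good_iff[of Y] by simp_all

section \<open>The limit homeomorphism\<close>

lemma approx_tendsto_phi:
  assumes "good Y" "s \<in> {0..1}"
  shows "(\<lambda>n. approx n Y s) \<longlonglongrightarrow> phi Y s"
proof -
  have Y: "\<And>s. Y s \<in> {0<..<1}" and m: "(\<lambda>n. mesh n Y) \<longlonglongrightarrow> 0"
    using assms(1) by (auto simp: good_def)
  have "Cauchy (\<lambda>n. approx n Y s)"
  proof (rule metric_CauchyI)
    fix e :: real assume "0 < e"
    then have "0 < e / 2" by simp
    from LIMSEQ_D[OF m this] obtain N where N: "norm (mesh N Y - 0) < e / 2" by blast
    have *: "\<bar>approx k Y s - approx N Y s\<bar> < e / 2" if "N \<le> k" for k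
      using approx_diff_le_mesh[of Y s N k] Y assms(2) that N by simp
    have "dist (approx k Y s) (approx l Y s) < e" if "N \<le> k" "N \<le> l" for k l
      using *[OF that(1)] *[OF that(2)] unfolding dist_real_def abs_less_iff by linarith
    then show "\<exists>M. \<forall>k\<ge>M. \<forall>l\<ge>M. dist (approx k Y s) (approx l Y s) < e" by blast
  qed
  then show ?thesis
    unfolding phi_def by (simp add: Cauchy_convergent_iff convergent_LIMSEQ_iff)
qed

lemma phi_diff_le_mesh:
  assumes "good Y" "s \<in> {0..1}"
  shows "\<bar>phi Y s - approx n Y s\<bar> \<le> mesh n Y"
proof (rule tendsto_upperbound)
  show "(\<lambda>m. \<bar>approx m Y s - approx n Y s\<bar>) \<longlonglongrightarrow> \<bar>phi Y s - approx n Y s\<bar>"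
    by (intro tendsto_intros approx_tendsto_phi assms)
  show "\<forall>\<^sub>F m in sequentially. \<bar>approx m Y s - approx n Y s\<bar> \<le> mesh n Y"
    using eventually_ge_at_top[of n]
    by eventually_elim (use assms in \<open>auto intro!: approx_diff_le_mesh simp: good_def\<close>)
qed simp

lemma phi_0: "good Y \<Longrightarrow> phi Y 0 = 0" and phi_1: "good Y \<Longrightarrow> phi Y 1 = 1"
  by (simp_all add: phi_def)

lemma phi_left:
  assumes "good Y" "0 \<le> s" "s \<le> 1/2"
  shows "phi Y s = Y [] * phi (subtree False Y) (2 * s)"
proof (rule LIMSEQ_unique)
  show "(\<lambda>n. approx (Suc n) Y s) \<longlonglongrightarrow> phi Y s"
    using assms by (intro LIMSEQ_Suc approx_tendsto_phi) auto
  show "(\<lambda>n. approx (Suc n) Y s) \<longlonglongrightarrow> Y [] * phi (subtree False Y) (2 * s)"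
    unfolding approx_left[OF assms(3)]
    using assms by (intro tendsto_intros approx_tendsto_phi good_subtree) auto
qed

lemma phi_right:
  assumes "good Y" "1/2 \<le> s" "s \<le> 1"
  shows "phi Y s = Y [] + (1 - Y []) * phi (subtree True Y) (2 * s - 1)"
proof (rule LIMSEQ_unique)
  show "(\<lambda>n. approx (Suc n) Y s) \<longlonglongrightarrow> phi Y s"
    using assms by (intro LIMSEQ_Suc approx_tendsto_phi) auto
  show "(\<lambda>n. approx (Suc n) Y s) \<longlonglongrightarrow> Y [] + (1 - Y []) * phi (subtree True Y) (2 * s - 1)"
    unfolding approx_right[OF assms(2)]
    using assms by (intro tendsto_intros approx_tendsto_phi good_subtree) auto
qed

lemma phi_mono:
  assumes "good Y" "0 \<le> s" "s \<le> s'" "s' \<le> 1"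
  shows "phi Y s \<le> phi Y s'"
proof (rule LIMSEQ_le)
  show "(\<lambda>n. approx n Y s) \<longlonglongrightarrow> phi Y s" "(\<lambda>n. approx n Y s') \<longlonglongrightarrow> phi Y s'"
    using assms by (auto intro!: approx_tendsto_phi)
  show "\<exists>N. \<forall>n\<ge>N. approx n Y s \<le> approx n Y s'"
    using assms by (auto intro!: approx_mono simp: good_def)
qed

text \<open>Left of the midpoint the value is at most \<open>Y []\<close>. To its right, zooming
  into the right half doubles the distance to 1, which can happen only finitely often; for
  \<open>n = 0\<close> the assumption is contradictory.\<close>

lemma phi_less_1:
  assumes "good Y" "0 \<le> s" "s < 1"
  shows "phi Y s < 1"
proof -
  have "phi Y s < 1" if "good Y" "0 \<le> s" "1 / 2 ^ n < 1 - s" for n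
    using that
  proof (induction n arbitrary: Y s)
    case (Suc n)
    note Y = good_root[OF Suc.prems(1)]
    show ?case
    proof (cases "s \<le> 1/2")
      case True
      have "phi Y s \<le> phi Y (1/2)"
        using Suc.prems True by (intro phi_mono) auto
      also have "\<dots> = Y []"
        using phi_left[OF Suc.prems(1), of "1/2"] phi_1[OF good_subtree[OF Suc.prems(1)]] by simp
      finally show ?thesis using Y by simp
    next
      case False
      have "phi (subtree True Y) (2 * s - 1) < 1"
        using False Suc.prems by (intro Suc.IH good_subtree) (auto simp: field_simps)
      then have "(1 - Y []) * phi (subtree True Y) (2 * s - 1) < (1 - Y []) * 1"
        using Y by (intro mult_strict_left_mono) auto
      moreover have "s \<le> 1"
        using Suc.prems(3) by (smt (verit) divide_nonneg_nonneg zero_le_power)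
      ultimately show ?thesis
        using False phi_right[OF Suc.prems(1), of s] by simp
    qed
  qed simp
  moreover obtain n where "1 / 2 ^ n < 1 - s"
    using assms(3) real_arch_pow_inv[of "1 - s" "1/2"] by (auto simp: power_divide)
  ultimately show ?thesis using assms by blast
qed

text \<open>Zooming into a half that contains both points doubles their distance, so after finitely
  many zooms the midpoint separates them. Strictness there comes from the left point through
  \<open>phi_less_1\<close>.\<close>

lemma phi_strict_mono: "good Y \<Longrightarrow> strict_mono_on {0..1} (phi Y)"
proof -
  have "phi Y s < phi Y s'" if "good Y" "0 \<le> s" "s' \<le> 1" "1 / 2 ^ n < s' - s" for n Y s s'
    using that
  proof (induction n arbitrary: Y s s')
    case (Suc n)
    note Y = good_root[OF Suc.prems(1)]
    have pos: "s < s'" using Suc.prems(4) by (smt (verit) divide_nonneg_nonneg zero_le_power)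
    consider "s' \<le> 1/2" | "1/2 \<le> s" | "s < 1/2" "1/2 < s'" by linarith
    then show ?case
    proof cases
      case 1
      have "phi (subtree False Y) (2 * s) < phi (subtree False Y) (2 * s')"
        using Suc.prems 1 by (intro Suc.IH good_subtree) (auto simp: field_simps)
      then show ?thesis
        using phi_left[OF Suc.prems(1)] 1 pos Suc.prems(2) Y by simp
    next
      case 2
      have "phi (subtree True Y) (2 * s - 1) < phi (subtree True Y) (2 * s' - 1)"
        using Suc.prems 2 by (intro Suc.IH good_subtree) (auto simp: field_simps)
      then show ?thesis
        using phi_right[OF Suc.prems(1)] 2 pos Suc.prems(3) Y by simp
    next
      case 3
      have "phi Y s = Y [] * phi (subtree False Y) (2 * s)"
        using 3 Suc.prems by (intro phi_left) auto
      also have "\<dots> < Y [] * 1"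
        using 3 Suc.prems Y by (intro mult_strict_left_mono phi_less_1 good_subtree) auto
      also have "\<dots> = phi Y (1/2)"
        using phi_left[OF Suc.prems(1), of "1/2"] phi_1[OF good_subtree[OF Suc.prems(1)]] by simp
      also have "\<dots> \<le> phi Y s'"
        using 3 Suc.prems by (intro phi_mono) auto
      finally show ?thesis .
    qed
  qed simp
  moreover have "\<exists>n. 1 / 2 ^ n < s' - s" if "s < s'" for s s' :: real
    using that real_arch_pow_inv[of "s' - s" "1/2"] by (auto simp: power_divide)
  moreover assume "good Y"
  ultimately show ?thesis by (auto intro!: strict_mono_onI) blast
qed

text \<open>Continuity is joint in the point and in the tree, for the product topology; this is the
  source of measurability of the random function.\<close>

lemma continuous_approx: "continuous_on UNIV (\<lambda>z. approx n (fst z) (snd z))"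
proof (induction n)
  case 0
  show ?case by (simp add: continuous_on_snd continuous_on_id)
next
  case (Suc n)
  have coord: "continuous_on UNIV (\<lambda>z :: (bool list \<Rightarrow> real) \<times> real. fst z s)" for s
    by (rule continuous_on_product_then_coordinatewise) (rule continuous_on_fst, rule continuous_on_id)
  have sub: "continuous_on UNIV (\<lambda>z :: (bool list \<Rightarrow> real) \<times> real. subtree b (fst z))" for b
    unfolding subtree_def by (rule continuous_on_coordinatewise_then_product) (rule coord)
  have comp: "continuous_on UNIV (\<lambda>z :: (bool list \<Rightarrow> real) \<times> real. approx n (subtree b (fst z)) (g (snd z)))"
    if "continuous_on UNIV g" for b and g :: "real \<Rightarrow> real"
  proof -
    have "continuous_on UNIV (\<lambda>z :: (bool list \<Rightarrow> real) \<times> real. g (snd z))"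
      by (rule continuous_on_compose2[OF that]) (auto intro!: continuous_intros)
    then have "continuous_on UNIV (\<lambda>z :: (bool list \<Rightarrow> real) \<times> real. (subtree b (fst z), g (snd z)))"
      by (intro continuous_on_Pair sub)
    then show ?thesis
      using continuous_on_compose2[OF Suc] by fastforce
  qed
  have "continuous_on UNIV (\<lambda>s::real. min 1 (2 * s))" "continuous_on UNIV (\<lambda>s::real. max 0 (2 * s - 1))"
    by (intro continuous_intros)+
  from comp[OF this(1), of False] comp[OF this(2), of True] show ?case
    by (auto intro!: continuous_intros coord)
qed

lemma continuous_on_approx: "continuous_on {0..1} (approx n Y)"
  using continuous_on_compose2[OF continuous_approx[of n], of "{0..1}" "\<lambda>s. (Y, s)"]
  by (simp add: continuous_on_Pair continuous_on_const continuous_on_id)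

lemma continuous_on_phi: "good Y \<Longrightarrow> continuous_on {0..1} (phi Y)"
proof (rule uniform_limit_theorem)
  assume Y: "good Y"
  show "\<forall>\<^sub>F n in sequentially. continuous_on {0..1} (approx n Y)" by (simp add: continuous_on_approx)
  show "uniform_limit {0..1} (\<lambda>n. approx n Y) (phi Y) sequentially"
  proof (rule uniform_limitI)
    fix e :: real assume "0 < e"
    then have "\<forall>\<^sub>F n in sequentially. dist (mesh n Y) 0 < e"
      using Y by (auto simp: good_def tendsto_iff)
    then show "\<forall>\<^sub>F n in sequentially. \<forall>s\<in>{0..1}. dist (approx n Y s) (phi Y s) < e"
    proof eventually_elim
      fix n assume "dist (mesh n Y) 0 < e"
      then show "\<forall>s\<in>{0..1}. dist (approx n Y s) (phi Y s) < e"
        using phi_diff_le_mesh[OF Y, of _ n] by (fastforce simp: dist_real_def abs_minus_commute)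
    qed
  qed
qed simp

section \<open>Dyadic arrays and trees\<close>

text \<open>The node of the tree that carries \<open>X n k\<close> is addressed by the \<open>n - 1\<close> binary digits of
  \<open>k div 2\<close>, the most significant one first.\<close>

primrec dyadic_path :: "nat \<Rightarrow> nat \<Rightarrow> bool list" where
  "dyadic_path 0 j = []"
| "dyadic_path (Suc n) j = (2 ^ n \<le> j) # dyadic_path n (j mod 2 ^ n)"

definition dyadic_array :: "(bool list \<Rightarrow> real) \<Rightarrow> nat \<Rightarrow> nat \<Rightarrow> real" where
  "dyadic_array Y n k = Y (dyadic_path (n - 1) (k div 2))"

definition dyadic_eqs :: "(nat \<Rightarrow> nat \<Rightarrow> real) \<Rightarrow> (real \<Rightarrow> real) \<Rightarrow> bool" where
  "dyadic_eqs X h \<longleftrightarrow> (\<forall>n k. 1 \<le> n \<longrightarrow> odd k \<longrightarrow> k < 2 ^ n \<longrightarrow>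
        h (real k / 2 ^ n) =
          h ((real k - 1) / 2 ^ n) +
          X n k * (h ((real k + 1) / 2 ^ n) - h ((real k - 1) / 2 ^ n)))"

text \<open>A continuous injection of an interval is strictly monotone, and the endpoint values
  exclude the decreasing case. Unlike the existence of an inverse, monotonicity passes directly to
  rescaled halves.\<close>

lemma dyadic_homeo_iff:
  "dyadic_homeo X h \<longleftrightarrow> continuous_on {0..1} h \<and> strict_mono_on {0..1} h \<and> h 0 = 0 \<and> h 1 = 1 \<and> dyadic_eqs X h"
proof -
  have "(\<exists>g. homeomorphism {0..1} {0..1} h g) \<longleftrightarrow> continuous_on {0..1} h \<and> strict_mono_on {0..1} h"
    if h: "h 0 = 0" "h 1 = 1"
  proof
    assume "\<exists>g. homeomorphism {0..1} {0..1} h g"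
    then obtain g where g: "homeomorphism {0..1} {0..1} h g" by blast
    then have "continuous_on {0..1} h" "inj_on h {0..1}"
      by (auto simp: homeomorphism_def intro: inj_on_inverseI)
    moreover have "\<not> strict_antimono_on {0..1} h"
      using monotone_onD[of "{0..1}" "(<)" "\<lambda>x y. y < x" h 0 1] h by auto
    ultimately show "continuous_on {0..1} h \<and> strict_mono_on {0..1} h"
      using injective_eq_monotone_map[of "{0..1}" h] by (simp add: is_interval_cc)
  next
    assume *: "continuous_on {0..1} h \<and> strict_mono_on {0..1} h"
    then have mono: "s \<le> s' \<Longrightarrow> s \<in> {0..1} \<Longrightarrow> s' \<in> {0..1} \<Longrightarrow> h s \<le> h s'" for s s'
      using strict_mono_onD[of "{0..1}" h s s'] by (cases "s = s'") auto
    have "h ` {0..1} = {0..1}"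
    proof
      show "h ` {0..1} \<subseteq> {0..1}"
        using mono[of 0] mono[of _ 1] h by force
      show "{0..1} \<subseteq> h ` {0..1}"
        using IVT'[of h 0 _ 1] h * by force
    qed
    then show "\<exists>g. homeomorphism {0..1} {0..1} h g"
      using * by (intro homeomorphism_compact) (auto intro: strict_mono_on_imp_inj_on)
  qed
  then show ?thesis
    unfolding dyadic_homeo_def dyadic_eqs_def by blast
qed

lemma dyadic_array_root: "dyadic_array Y 1 1 = Y []"
  by (simp add: dyadic_array_def)

lemma dyadic_array_left:
  assumes "1 \<le> n" "k < 2 ^ n"
  shows "dyadic_array Y (Suc n) k = dyadic_array (subtree False Y) n k"
proof -
  obtain m where n: "n = Suc m" using assms(1) by (cases n) auto
  have "k div 2 < 2 ^ m" using assms(2) n by (simp add: less_mult_imp_div_less mult.commute)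
  then show ?thesis by (simp add: dyadic_array_def n subtree_def)
qed

lemma dyadic_array_right:
  assumes "1 \<le> n" "k < 2 ^ n"
  shows "dyadic_array Y (Suc n) (2 ^ n + k) = dyadic_array (subtree True Y) n k"
proof -
  obtain m where n: "n = Suc m" using assms(1) by (cases n) auto
  have "k div 2 < 2 ^ m" using assms(2) n by (simp add: less_mult_imp_div_less mult.commute)
  moreover have "(2 ^ n + k) div 2 = 2 ^ m + k div 2" by (simp add: n)
  ultimately show ?thesis by (simp add: dyadic_array_def n subtree_def)
qed

text \<open>The recursion fixes the ratio in which \<open>u\<close> divides the segment from
  \<open>v\<close> to \<open>w\<close>, and affine maps preserve ratios.\<close>

lemma recursion_mult_add:
  fixes u v w a c d :: real
  assumes "u = v + a * (w - v)"
  shows "d + c * u = (d + c * v) + a * ((d + c * w) - (d + c * v))"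
  unfolding assms by (simp add: algebra_simps)

lemma dyadic_eqs_phi:
  assumes "good Y"
  shows "dyadic_eqs (dyadic_array Y) (phi Y)"
  unfolding dyadic_eqs_def
proof (intro allI impI)
  fix n k :: nat assume n: "1 \<le> n" and k: "odd k" "k < 2 ^ n"
  show "phi Y (real k / 2 ^ n) = phi Y ((real k - 1) / 2 ^ n) +
     dyadic_array Y n k * (phi Y ((real k + 1) / 2 ^ n) - phi Y ((real k - 1) / 2 ^ n))"
    using n k assms
  proof (induction n arbitrary: k Y rule: nat_induct_at_least)
    case base
    then have "k = 1" by (cases k) auto
    then show ?case
      using phi_left[OF base.prems(3), of "1/2"] phi_1[OF base.prems(3)] phi_0[OF base.prems(3)]
        phi_1[OF good_subtree[OF base.prems(3)]] dyadic_array_root by simp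
  next
    case (Suc n)
    have even: "even (2 ^ n :: nat)" using Suc.hyps by simp
    have k1: "1 \<le> k" using Suc.prems(1) by (cases k) auto
    show ?case
    proof (cases "k < 2 ^ n")
      case True
      then have "real (k + 1) \<le> real (2 ^ n)" by (simp only: of_nat_le_iff)
      then have "real k + 1 \<le> 2 ^ n" by simp
      then have eq: "phi Y (j / 2 ^ Suc n) = Y [] * phi (subtree False Y) (j / 2 ^ n)"
        if "j \<in> {real k, real k - 1, real k + 1}" for j
      proof -
        have "0 \<le> j" "j \<le> 2 ^ n" using that k1 \<open>real k + 1 \<le> 2 ^ n\<close> True by auto
        then have "0 \<le> j / 2 ^ Suc n" "j / 2 ^ Suc n \<le> 1/2" by (simp_all add: field_simps)
        then show ?thesis using phi_left[OF Suc.prems(3)] by simp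
      qed
      have rec: "phi (subtree False Y) (real k / 2 ^ n) = phi (subtree False Y) ((real k - 1) / 2 ^ n) +
        dyadic_array (subtree False Y) n k * (phi (subtree False Y) ((real k + 1) / 2 ^ n) - phi (subtree False Y) ((real k - 1) / 2 ^ n))"
        by (rule Suc.IH[OF Suc.prems(1) True good_subtree[OF Suc.prems(3)]])
      show ?thesis
        using recursion_mult_add[OF rec, of 0 "Y []"] eq dyadic_array_left[OF Suc.hyps(1) True] by simp
    next
      case False
      \<comment> \<open>As \<open>k\<close> is odd and \<open>2 ^ n\<close> is even,
        \<open>l\<close> is at least 1, so the neighbours \<open>k - 1\<close> and
        \<open>k + 1\<close> stay in the closed right half.\<close>
      define l where "l = k - 2 ^ n"
      have k: "k = 2 ^ n + l" using False by (simp add: l_def)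
      have l: "odd l" "l < 2 ^ n" using Suc.prems k even by auto
      then have "1 \<le> l" "l + 1 \<le> 2 ^ n" by (cases l; simp)+
      then have "real (l + 1) \<le> real (2 ^ n)" by (simp only: of_nat_le_iff)
      then have l': "1 \<le> real l" "real l + 1 \<le> 2 ^ n" using \<open>1 \<le> l\<close> by simp_all
      have eq: "phi Y ((2 ^ n + j) / 2 ^ Suc n) = Y [] + (1 - Y []) * phi (subtree True Y) (j / 2 ^ n)"
        if "j \<in> {real l, real l - 1, real l + 1}" for j
      proof -
        have "2 * ((2 ^ n + j) / 2 ^ Suc n) - 1 = j / 2 ^ n" by (simp add: field_simps)
        moreover have "0 \<le> j" "j \<le> 2 ^ n" using that l' l(2) by auto
        then have "1/2 \<le> (2 ^ n + j) / 2 ^ Suc n" "(2 ^ n + j) / 2 ^ Suc n \<le> 1" by (simp_all add: field_simps)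
        ultimately show ?thesis using phi_right[OF Suc.prems(3), of "(2 ^ n + j) / 2 ^ Suc n"] by simp
      qed
      have rec: "phi (subtree True Y) (real l / 2 ^ n) = phi (subtree True Y) ((real l - 1) / 2 ^ n) +
        dyadic_array (subtree True Y) n l * (phi (subtree True Y) ((real l + 1) / 2 ^ n) - phi (subtree True Y) ((real l - 1) / 2 ^ n))"
        by (rule Suc.IH[OF l good_subtree[OF Suc.prems(3)]])
      note recursion_mult_add[OF rec, of "Y []" "1 - Y []"]
      moreover have "phi Y (real k / 2 ^ Suc n) = Y [] + (1 - Y []) * phi (subtree True Y) (real l / 2 ^ n)"
        "phi Y ((real k - 1) / 2 ^ Suc n) = Y [] + (1 - Y []) * phi (subtree True Y) ((real l - 1) / 2 ^ n)"
        "phi Y ((real k + 1) / 2 ^ Suc n) = Y [] + (1 - Y []) * phi (subtree True Y) ((real l + 1) / 2 ^ n)"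
        using eq[of "real l"] eq[of "real l - 1"] eq[of "real l + 1"] by (simp_all add: k add_diff_eq add.assoc)
      moreover have "dyadic_array Y (Suc n) k = dyadic_array (subtree True Y) n l"
        using dyadic_array_right[OF Suc.hyps(1) l(2)] k by simp
      ultimately show ?thesis by (simp only:)
    qed
  qed
qed

lemma dyadic_homeo_phi: "good Y \<Longrightarrow> dyadic_homeo (dyadic_array Y) (phi Y)"
  by (simp add: dyadic_homeo_iff continuous_on_phi phi_strict_mono phi_0 phi_1 dyadic_eqs_phi)

section \<open>Uniqueness of the dyadic homeomorphism\<close>

lemma recursion_diff_divide:
  fixes u v w a c d :: real
  assumes "u = v + a * (w - v)"
  shows "(u - d) / c = (v - d) / c + a * ((w - d) / c - (v - d) / c)"
  using recursion_mult_add[OF assms, of "- d / c" "1 / c"] by (simp add: diff_divide_distrib)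

text \<open>Both halves of a solution, rescaled to the unit square, solve the problem for the
  subtrees. Every later induction about an arbitrary solution \<open>h\<close> descends along
  this.\<close>

lemma dyadic_homeo_split:
  assumes "dyadic_homeo (dyadic_array Y) h"
  shows "Y [] = h (1/2)" "Y [] \<in> {0<..<1}"
    and "dyadic_homeo (dyadic_array (subtree False Y)) (\<lambda>s. h (s / 2) / Y [])" (is "dyadic_homeo _ ?l")
    and "dyadic_homeo (dyadic_array (subtree True Y)) (\<lambda>s. (h ((s + 1) / 2) - Y []) / (1 - Y []))" (is "dyadic_homeo _ ?r")
proof -
  have cont: "continuous_on {0..1} h" and mono: "strict_mono_on {0..1} h" and h: "h 0 = 0" "h 1 = 1"
    and eqs: "\<And>n k. 1 \<le> n \<Longrightarrow> odd k \<Longrightarrow> k < 2 ^ n \<Longrightarrow> h (real k / 2 ^ n) =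
          h ((real k - 1) / 2 ^ n) + dyadic_array Y n k * (h ((real k + 1) / 2 ^ n) - h ((real k - 1) / 2 ^ n))"
    using assms by (auto simp: dyadic_homeo_iff dyadic_eqs_def)
  show root: "Y [] = h (1/2)"
    using eqs[of 1 1] dyadic_array_root[of Y] h by simp
  show Y: "Y [] \<in> {0<..<1}"
    using strict_mono_onD[OF mono, of 0 "1/2"] strict_mono_onD[OF mono, of "1/2" 1] h root by simp
  have eqs': "h (j / 2 ^ Suc n) = h ((j - 1) / 2 ^ Suc n) + dyadic_array Y (Suc n) k * (h ((j + 1) / 2 ^ Suc n) - h ((j - 1) / 2 ^ Suc n))"
    if "odd k" "k < 2 ^ Suc n" "j = real k" for n k j
    using eqs[of "Suc n" k] that by simp
  have "continuous_on {0..1} (\<lambda>s. h (s / 2))" "continuous_on {0..1} (\<lambda>s. h ((s + 1) / 2))"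
    by (rule continuous_on_compose2[OF cont]; auto intro!: continuous_intros)+
  then have c: "continuous_on {0..1} ?l" "continuous_on {0..1} ?r"
    using Y by (auto intro!: continuous_intros)
  have m: "strict_mono_on {0..1} ?l" "strict_mono_on {0..1} ?r"
    using Y by (auto intro!: strict_mono_onI divide_strict_right_mono strict_mono_onD[OF mono])
  have "dyadic_eqs (dyadic_array (subtree False Y)) ?l"
    unfolding dyadic_eqs_def
  proof (intro allI impI)
    fix n k :: nat assume n: "1 \<le> n" "odd k" "k < 2 ^ n"
    have rec: "h (real k / 2 ^ Suc n) = h ((real k - 1) / 2 ^ Suc n)
        + dyadic_array (subtree False Y) n k * (h ((real k + 1) / 2 ^ Suc n) - h ((real k - 1) / 2 ^ Suc n))"
      using eqs'[of k n "real k"] n dyadic_array_left[OF n(1,3)] by simp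
    have half: "j / 2 ^ n / 2 = j / 2 ^ Suc n" for j :: real by simp
    show "?l (real k / 2 ^ n) = ?l ((real k - 1) / 2 ^ n)
      + dyadic_array (subtree False Y) n k * (?l ((real k + 1) / 2 ^ n) - ?l ((real k - 1) / 2 ^ n))"
      using recursion_diff_divide[OF rec, of 0 "Y []"] unfolding half diff_0_right .
  qed
  then show "dyadic_homeo (dyadic_array (subtree False Y)) ?l"
    using c m root h Y by (simp add: dyadic_homeo_iff)
  have "dyadic_eqs (dyadic_array (subtree True Y)) ?r"
    unfolding dyadic_eqs_def
  proof (intro allI impI)
    fix n k :: nat assume n: "1 \<le> n" "odd k" "k < 2 ^ n"
    have "h ((2 ^ n + real k) / 2 ^ Suc n) = h ((2 ^ n + real k - 1) / 2 ^ Suc n)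
        + dyadic_array (subtree True Y) n k * (h ((2 ^ n + real k + 1) / 2 ^ Suc n) - h ((2 ^ n + real k - 1) / 2 ^ Suc n))"
      using eqs'[of "2 ^ n + k" n "2 ^ n + real k"] n dyadic_array_right[OF n(1,3)] by simp
    moreover have "(real k / 2 ^ n + 1) / 2 = (2 ^ n + real k) / 2 ^ Suc n"
      "((real k - 1) / 2 ^ n + 1) / 2 = (2 ^ n + real k - 1) / 2 ^ Suc n"
      "((real k + 1) / 2 ^ n + 1) / 2 = (2 ^ n + real k + 1) / 2 ^ Suc n"
      by (simp_all add: field_simps)
    ultimately show "?r (real k / 2 ^ n) = ?r ((real k - 1) / 2 ^ n)
      + dyadic_array (subtree True Y) n k * (?r ((real k + 1) / 2 ^ n) - ?r ((real k - 1) / 2 ^ n))"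
      by (simp only: recursion_diff_divide)
  qed
  then show "dyadic_homeo (dyadic_array (subtree True Y)) ?r"
    using c m root h Y by (simp add: dyadic_homeo_iff)
qed

lemma dyadic_homeo_open:
  assumes "dyadic_homeo (dyadic_array Y) h"
  shows "Y s \<in> {0<..<1}"
  using assms
proof (induction s arbitrary: Y h)
  case Nil
  then show ?case by (rule dyadic_homeo_split(2))
next
  case (Cons b s)
  then have "subtree b Y s \<in> {0<..<1}"
    using Cons.IH[OF dyadic_homeo_split(3)[OF Cons.prems]] Cons.IH[OF dyadic_homeo_split(4)[OF Cons.prems]]
    by (cases b) simp_all
  then show ?case by (simp add: subtree_def)
qed

text \<open>The maximum in the recursion of \<open>mesh\<close> is attained in one of the halves,
  which locates the interval. Uniform continuity of \<open>h\<close> then forces the mesh to tend to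
  0.\<close>

lemma dyadic_homeo_mesh:
  assumes "dyadic_homeo (dyadic_array Y) h"
  shows "\<exists>a\<in>{0..1}. \<exists>b\<in>{0..1}. b - a = 1 / 2 ^ n \<and> mesh n Y = h b - h a"
  using assms
proof (induction n arbitrary: Y h)
  case 0
  then have "1 - 0 = 1 / (2::real) ^ 0 \<and> mesh 0 Y = h 1 - h 0" by (simp add: dyadic_homeo_iff)
  then show ?case by (intro bexI[of _ 0] bexI[of _ 1]) auto
next
  case (Suc n)
  note Y = dyadic_homeo_split(2)[OF Suc.prems]
  obtain a b where l: "a \<in> {0..1}" "b \<in> {0..1}" "b - a = 1 / 2 ^ n"
    "mesh n (subtree False Y) = h (b / 2) / Y [] - h (a / 2) / Y []"
    using Suc.IH[OF dyadic_homeo_split(3)[OF Suc.prems]] by blast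
  obtain c d where r: "c \<in> {0..1}" "d \<in> {0..1}" "d - c = 1 / 2 ^ n"
    "mesh n (subtree True Y) = (h ((d + 1) / 2) - Y []) / (1 - Y []) - (h ((c + 1) / 2) - Y []) / (1 - Y [])"
    using Suc.IH[OF dyadic_homeo_split(4)[OF Suc.prems]] by blast
  have "Y [] * mesh n (subtree False Y) = h (b / 2) - h (a / 2)"
    using Y l(4) by (simp add: field_simps)
  moreover have "(1 - Y []) * mesh n (subtree True Y) = h ((d + 1) / 2) - h ((c + 1) / 2)"
    using Y r(4) by (simp add: diff_divide_distrib[symmetric])
  ultimately have "mesh (Suc n) Y = h (b / 2) - h (a / 2) \<or> mesh (Suc n) Y = h ((d + 1) / 2) - h ((c + 1) / 2)"
    by (simp add: max_def)
  then show ?case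
  proof (elim disjE)
    assume 1: "mesh (Suc n) Y = h (b / 2) - h (a / 2)"
    then show ?thesis using l by (intro bexI[of _ "a / 2"] bexI[of _ "b / 2"]) auto
  next
    assume 2: "mesh (Suc n) Y = h ((d + 1) / 2) - h ((c + 1) / 2)"
    have "(d + 1) / 2 - (c + 1) / 2 = 1 / 2 ^ Suc n" using r(3) by (simp add: field_simps)
    moreover have "(c + 1) / 2 \<in> {0..1}" "(d + 1) / 2 \<in> {0..1}" using r(1,2) by auto
    ultimately show ?thesis using 2 by blast
  qed
qed

lemma dyadic_homeo_imp_good:
  assumes "dyadic_homeo (dyadic_array Y) h"
  shows "good Y"
  unfolding good_def
proof (intro conjI allI)
  show "Y s \<in> {0<..<1}" for s by (rule dyadic_homeo_open[OF assms])
  show "(\<lambda>n. mesh n Y) \<longlonglongrightarrow> 0"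
  proof (rule tendstoI)
    fix e :: real assume "0 < e"
    have "uniformly_continuous_on {0..1} h"
      using assms by (intro compact_uniformly_continuous) (auto simp: dyadic_homeo_iff)
    then obtain d where d: "0 < d" "\<And>a b. a \<in> {0..1} \<Longrightarrow> b \<in> {0..1} \<Longrightarrow> dist b a < d \<Longrightarrow> dist (h b) (h a) < e"
      using \<open>0 < e\<close> unfolding uniformly_continuous_on_def by metis
    have "(\<lambda>n. 1 / 2 ^ n :: real) \<longlonglongrightarrow> 0"
      using LIMSEQ_power_zero[of "1/2 :: real"] by (simp add: power_divide)
    then have "\<forall>\<^sub>F n in sequentially. dist (1 / 2 ^ n :: real) 0 < d"
      using d(1) by (rule tendstoD)
    then show "\<forall>\<^sub>F n in sequentially. dist (mesh n Y) 0 < e"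
    proof eventually_elim
      fix n assume n: "dist (1 / 2 ^ n :: real) 0 < d"
      obtain a b where ab: "a \<in> {0..1}" "b \<in> {0..1}" "b - a = 1 / 2 ^ n" "mesh n Y = h b - h a"
        using dyadic_homeo_mesh[OF assms] by blast
      have "dist b a < d" using n ab(3) by (simp add: dist_real_def)
      from d(2)[OF ab(1,2) this] show "dist (mesh n Y) 0 < e"
        using ab(4) by (simp add: dist_real_def)
    qed
  qed
qed

lemma dyadic_homeo_approx:
  assumes "dyadic_homeo (dyadic_array Y) h" "s \<in> {0..1}"
  shows "\<bar>h s - approx n Y s\<bar> \<le> mesh n Y"
  using assms
proof (induction n arbitrary: Y h s)
  case 0
  then have "strict_mono_on {0..1} h" "h 0 = 0" "h 1 = 1" by (auto simp: dyadic_homeo_iff)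
  then have "0 \<le> h s" "h s \<le> 1"
    using strict_mono_on_leD[of "{0..1}" h 0 s] strict_mono_on_leD[of "{0..1}" h s 1] 0(2) by auto
  then show ?case using 0(2) by (auto simp: abs_le_iff)
next
  case (Suc n)
  note Y = dyadic_homeo_split(2)[OF Suc.prems(1)]
  show ?case
  proof (cases "s \<le> 1/2")
    case True
    have "\<bar>h (2 * s / 2) / Y [] - approx n (subtree False Y) (2 * s)\<bar> \<le> mesh n (subtree False Y)"
      using True Suc.prems(2) by (intro Suc.IH[OF dyadic_homeo_split(3)[OF Suc.prems(1)]]) auto
    then have "Y [] * \<bar>h s / Y [] - approx n (subtree False Y) (2 * s)\<bar> \<le> Y [] * mesh n (subtree False Y)"
      using Y by (intro mult_left_mono) auto
    moreover have "Y [] * \<bar>h s / Y [] - approx n (subtree False Y) (2 * s)\<bar>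
        = \<bar>Y [] * (h s / Y [] - approx n (subtree False Y) (2 * s))\<bar>"
      using Y by (simp add: abs_mult)
    moreover have "Y [] * (h s / Y [] - approx n (subtree False Y) (2 * s)) = h s - approx (Suc n) Y s"
      unfolding approx_left[OF True] using Y by (simp add: right_diff_distrib)
    ultimately have "\<bar>h s - approx (Suc n) Y s\<bar> \<le> Y [] * mesh n (subtree False Y)" by simp
    then show ?thesis by simp
  next
    case False
    then have s: "1/2 \<le> s" by simp
    have "\<bar>(h ((2 * s - 1 + 1) / 2) - Y []) / (1 - Y []) - approx n (subtree True Y) (2 * s - 1)\<bar> \<le> mesh n (subtree True Y)"
      using s Suc.prems(2) by (intro Suc.IH[OF dyadic_homeo_split(4)[OF Suc.prems(1)]]) auto
    then have "(1 - Y []) * \<bar>(h s - Y []) / (1 - Y []) - approx n (subtree True Y) (2 * s - 1)\<bar> \<le> (1 - Y []) * mesh n (subtree True Y)"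
      using Y by (intro mult_left_mono) auto
    moreover have "(1 - Y []) * \<bar>(h s - Y []) / (1 - Y []) - approx n (subtree True Y) (2 * s - 1)\<bar>
        = \<bar>(1 - Y []) * ((h s - Y []) / (1 - Y []) - approx n (subtree True Y) (2 * s - 1))\<bar>"
      using Y by (simp add: abs_mult)
    moreover have "(1 - Y []) * ((h s - Y []) / (1 - Y []) - approx n (subtree True Y) (2 * s - 1)) = h s - approx (Suc n) Y s"
      unfolding approx_right[OF s] right_diff_distrib using Y by simp
    ultimately have "\<bar>h s - approx (Suc n) Y s\<bar> \<le> (1 - Y []) * mesh n (subtree True Y)" by simp
    then show ?thesis by simp
  qed
qed

text \<open>Both functions are limits of the same interpolations. Hence the choice in
  \<open>random_homeo\<close> has only one possible outcome on \<open>[0, 1]\<close>.\<close>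

lemma dyadic_homeo_eq_phi:
  assumes "dyadic_homeo (dyadic_array Y) h" "s \<in> {0..1}"
  shows "h s = phi Y s"
proof (rule LIMSEQ_unique)
  have g: "good Y" by (rule dyadic_homeo_imp_good[OF assms(1)])
  show "(\<lambda>n. approx n Y s) \<longlonglongrightarrow> phi Y s"
    by (rule approx_tendsto_phi[OF g assms(2)])
  have "(\<lambda>n. h s - approx n Y s) \<longlonglongrightarrow> 0"
  proof (rule Lim_null_comparison)
    show "\<forall>\<^sub>F n in sequentially. norm (h s - approx n Y s) \<le> mesh n Y"
      using dyadic_homeo_approx[OF assms] by simp
    show "(\<lambda>n. mesh n Y) \<longlonglongrightarrow> 0" using g by (simp add: good_def)
  qed
  from tendsto_diff[OF tendsto_const[of "h s"] this] show "(\<lambda>n. approx n Y s) \<longlonglongrightarrow> h s"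
    by simp
qed

lemma random_homeo_eq_phi:
  assumes "good Y" "s \<in> {0..1}"
  shows "random_homeo (dyadic_array Y) s = phi Y s"
proof -
  have ex: "\<exists>h. dyadic_homeo (dyadic_array Y) h" using dyadic_homeo_phi[OF assms(1)] by blast
  then have "dyadic_homeo (dyadic_array Y) (random_homeo (dyadic_array Y))"
    unfolding random_homeo_def by (simp add: someI_ex[OF ex])
  then show ?thesis using assms(2) by (rule dyadic_homeo_eq_phi)
qed

lemma random_homeo_not_good: "\<not> good Y \<Longrightarrow> random_homeo (dyadic_array Y) = (\<lambda>x. x)"
  using dyadic_homeo_imp_good unfolding random_homeo_def by auto

section \<open>Passing between dyadic arrays and trees\<close>

text \<open>Used to exchange the given array for the one read off from a tree; the two may differ at
  even \<open>k\<close>, for instance.\<close>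

lemma random_homeo_cong:
  assumes "\<And>n k. 1 \<le> n \<Longrightarrow> odd k \<Longrightarrow> k < 2 ^ n \<Longrightarrow> X n k = X' n k"
  shows "random_homeo X = random_homeo X'"
proof -
  have "dyadic_homeo X = dyadic_homeo X'"
    using assms by (auto simp: dyadic_homeo_def fun_eq_iff)
  then show ?thesis by (simp add: random_homeo_def)
qed

text \<open>The value of a word as a binary number, inverse to \<open>dyadic_path\<close> on words
  of a fixed length. The node \<open>s\<close> carries
  \<open>X (length s + 1) (2 * node_index s + 1)\<close>.\<close>

primrec node_index :: "bool list \<Rightarrow> nat" where
  "node_index [] = 0"
| "node_index (b # s) = (if b then 2 ^ length s else 0) + node_index s"

lemma length_dyadic_path [simp]: "length (dyadic_path n j) = n"
  by (induction n arbitrary: j) auto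

lemma node_index_less: "node_index s < 2 ^ length s"
  by (induction s) auto

lemma index_dyadic_path: "j < 2 ^ n \<Longrightarrow> node_index (dyadic_path n j) = j"
proof (induction n arbitrary: j)
  case (Suc n)
  show ?case
  proof (cases "2 ^ n \<le> j")
    case True
    then have "j mod 2 ^ n = j - 2 ^ n"
      using Suc.prems by (simp add: mod_nat_eqI)
    then show ?thesis using True Suc.prems Suc.IH[of "j mod 2 ^ n"] by simp
  next
    case False
    then show ?thesis using Suc.IH[of j] by simp
  qed
qed simp

lemma dyadic_path_index: "dyadic_path (length s) (node_index s) = s"
proof (induction s)
  case (Cons b s)
  have "(b \<longrightarrow> (2 ^ length s + node_index s) mod 2 ^ length s = node_index s) \<and> node_index s mod 2 ^ length s = node_index s"
    using node_index_less[of s] by simp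
  then show ?case using Cons node_index_less[of s] by auto
qed simp

lemma dyadic_array_index:
  assumes "1 \<le> n" "odd k" "k < 2 ^ n"
  shows "dyadic_array (\<lambda>s. X (length s + 1) (2 * node_index s + 1)) n k = X n k"
proof -
  obtain m where n: "n = Suc m" using assms(1) by (cases n) auto
  have "k div 2 < 2 ^ m" using assms(3) n by (simp add: less_mult_imp_div_less mult.commute)
  then show ?thesis
    using assms(2) by (simp add: dyadic_array_def n index_dyadic_path)
qed

section \<open>Stretched copies of the function on the circle\<close>

text \<open>The tent function with \<open>tent u = 2 * u\<close> on \<open>[0, 1/2]\<close>; it makes a function given on \<open>[0, 1]\<close>,
  whatever its endpoint values are, into an element of \<open>circle_fun\<close>.\<close>
definition tent :: "real \<Rightarrow> real" where
  "tent u = arccos (cos (2 * pi * u)) / pi"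

lemma tent_range: "tent u \<in> {0..1}"
  using arccos_bounded[of "cos (2 * pi * u)"] by (simp add: tent_def)

lemma tent_periodic: "tent (u + 1) = tent u"
proof -
  have "2 * pi * (u + 1) = 2 * pi * u + 2 * pi" by (simp add: algebra_simps)
  then show ?thesis by (simp add: tent_def)
qed

lemma tent_eq: "0 \<le> u \<Longrightarrow> u \<le> 1/2 \<Longrightarrow> tent u = 2 * u"
  by (simp add: tent_def arccos_cos)

lemma continuous_tent: "continuous_on UNIV tent"
  unfolding tent_def by (intro continuous_intros continuous_on_arccos) auto

text \<open>On \<open>{0..1/2}\<close> this is \<open>f (x + (y - x) * h (2 * u))\<close>, a full
  copy of \<open>f\<close> along \<open>h\<close> between the heights \<open>x\<close> and
  \<open>y\<close>. This is why the interval property is tested on \<open>{0..1/2}\<close>.\<close>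

definition stretch ::
  "(real \<Rightarrow>\<^sub>C 'b::{real_normed_field, euclidean_space}) \<Rightarrow> real \<Rightarrow> real \<Rightarrow> (real \<Rightarrow> real) \<Rightarrow> (real \<Rightarrow>\<^sub>C 'b)" where
  "stretch f x y h = Bcontfun (\<lambda>u. f (x + (y - x) * h (tent u)))"

lemma stretch_apply:
  assumes "continuous_on {0..1} h"
  shows "stretch f x y h u = f (x + (y - x) * h (tent u))"
proof -
  let ?g = "\<lambda>u. f (x + (y - x) * h (tent u))"
  have "continuous_on UNIV (\<lambda>u. h (tent u))"
    by (rule continuous_on_compose2[OF assms continuous_tent]) (use tent_range in auto)
  then have "continuous_on UNIV ?g"
    by (intro continuous_on_compose2[OF continuous_on_apply_bcontfun[of UNIV f]] continuous_intros) auto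
  moreover have "bounded (range ?g)"
    by (rule bounded_subset[OF bounded_apply_bcontfun[of f]]) auto
  ultimately have "?g \<in> bcontfun" by (simp add: bcontfun_def)
  then show ?thesis by (simp add: stretch_def Bcontfun_inverse)
qed

lemma stretch_in_circle_fun: "continuous_on {0..1} h \<Longrightarrow> stretch f x y h \<in> circle_fun"
  by (simp add: circle_fun_def stretch_apply tent_periodic)

section \<open>Borel measurability of the random function\<close>

lemma sets_tree_measure_eq_borel: "sets tree_measure = sets borel"
proof -
  have "sets tree_measure = sets (PiM (UNIV :: bool list set) (\<lambda>_. borel :: real measure))"
    unfolding tree_measure_def by (rule sets_PiM_cong) auto
  then show ?thesis by (simp add: sets_PiM_equal_borel)
qed

text \<open>Compactness of \<open>[0, 1]\<close> turns joint continuity in parameters and point into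
  continuity of the parametrised function in the supremum metric.\<close>

lemma continuous_stretch_approx:
  "continuous_on UNIV (\<lambda>w. stretch f (fst (fst w)) (snd (fst w)) (approx n (snd w)))"
  (is "continuous_on UNIV ?G")
proof -
  let ?H = "\<lambda>z :: ((real \<times> real) \<times> (bool list \<Rightarrow> real)) \<times> real.
    f (fst (fst (fst z)) + (snd (fst (fst z)) - fst (fst (fst z))) * approx n (snd (fst z)) (snd z))"
  have "continuous_on UNIV (\<lambda>z :: ((real \<times> real) \<times> (bool list \<Rightarrow> real)) \<times> real. (snd (fst z), snd z))"
    by (intro continuous_on_Pair continuous_on_snd continuous_on_fst continuous_on_id)
  from continuous_on_compose2[OF continuous_approx[of n] this]
  have "continuous_on UNIV (\<lambda>z :: ((real \<times> real) \<times> (bool list \<Rightarrow> real)) \<times> real. approx n (snd (fst z)) (snd z))"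
    by simp
  then have H: "continuous_on (UNIV \<times> {0..1}) ?H"
    by (intro continuous_on_compose2[OF continuous_on_apply_bcontfun[of UNIV f]] continuous_on_add
        continuous_on_mult continuous_on_diff continuous_on_snd continuous_on_fst continuous_on_id
        continuous_on_subset[of UNIV _ "UNIV \<times> {0..1}"]) auto
  have "(?G \<longlongrightarrow> ?G w0) (at w0)" for w0
  proof (rule tendstoI)
    fix e :: real assume "0 < e"
    then obtain U where U: "w0 \<in> U" "open U"
      "\<forall>w\<in>U \<inter> UNIV. \<forall>s\<in>{0..1}. dist (?H (w, s)) (?H (w0, s)) \<le> e / 2"
      using continuous_on_prod_compactE[OF H compact_Icc UNIV_I, of "e / 2" w0] by (metis half_gt_zero)
    have "dist (?G w) (?G w0) < e" if "w \<in> U" for w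
    proof -
      have "dist (?G w) (?G w0) \<le> e / 2"
      proof (rule dist_bound)
        fix u
        show "dist (?G w u) (?G w0 u) \<le> e / 2"
          using U(3) that tent_range[of u] by (simp add: stretch_apply continuous_on_approx)
      qed
      then show ?thesis using \<open>0 < e\<close> by simp
    qed
    then show "\<forall>\<^sub>F w in at w0. dist (?G w) (?G w0) < e"
      using U(1,2) unfolding eventually_at_topological by blast
  qed
  then show ?thesis by (simp add: continuous_on_def)
qed

text \<open>The interpolations converge uniformly, with error at most the mesh, and uniform
  continuity of \<open>f\<close> on the segment carries this over to the compositions.\<close>

lemma stretch_approx_tendsto:
  assumes "good Y"
  shows "(\<lambda>n. stretch f x y (approx n Y)) \<longlonglongrightarrow> stretch f x y (phi Y)"
proof (rule tendstoI)
  fix e :: real assume "0 < e"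
  have "continuous_on {0..1} (\<lambda>s. f (x + (y - x) * s))"
    by (intro continuous_on_compose2[OF continuous_on_apply_bcontfun[of UNIV f]] continuous_intros) auto
  then have "uniformly_continuous_on {0..1} (\<lambda>s. f (x + (y - x) * s))"
    by (intro compact_uniformly_continuous) auto
  then obtain d where d: "0 < d" "\<And>a b. a \<in> {0..1} \<Longrightarrow> b \<in> {0..1} \<Longrightarrow> dist b a < d \<Longrightarrow>
      dist (f (x + (y - x) * b)) (f (x + (y - x) * a)) < e / 2"
    using \<open>0 < e\<close> unfolding uniformly_continuous_on_def by (metis half_gt_zero)
  have Y: "\<And>s. Y s \<in> {0<..<1}" "(\<lambda>n. mesh n Y) \<longlonglongrightarrow> 0"
    using assms by (auto simp: good_def)
  have "\<forall>\<^sub>F n in sequentially. dist (mesh n Y) 0 < d"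
    by (rule tendstoD[OF Y(2) d(1)])
  then show "\<forall>\<^sub>F n in sequentially. dist (stretch f x y (approx n Y)) (stretch f x y (phi Y)) < e"
  proof eventually_elim
    fix n assume n: "dist (mesh n Y) 0 < d"
    have "dist (stretch f x y (approx n Y)) (stretch f x y (phi Y)) \<le> e / 2"
    proof (rule dist_bound)
      fix u
      note u = tent_range[of u]
      have "phi Y (tent u) \<in> {0..1}"
        using phi_mono[OF assms, of 0 "tent u"] phi_mono[OF assms, of "tent u" 1] u
          phi_0[OF assms] phi_1[OF assms] by simp
      moreover have "approx n Y (tent u) \<in> {0..1}"
        using approx_range[of Y "tent u" n] Y(1) u by blast
      moreover have "dist (approx n Y (tent u)) (phi Y (tent u)) < d"
        using phi_diff_le_mesh[OF assms u, of n] n by (simp add: dist_real_def abs_minus_commute)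
      ultimately have "dist (f (x + (y - x) * approx n Y (tent u))) (f (x + (y - x) * phi Y (tent u))) < e / 2"
        using d(2) by blast
      then show "dist (stretch f x y (approx n Y) u) (stretch f x y (phi Y) u) \<le> e / 2"
        by (simp add: stretch_apply continuous_on_approx continuous_on_phi assms)
    qed
    then show "dist (stretch f x y (approx n Y)) (stretch f x y (phi Y)) < e"
      using \<open>0 < e\<close> by simp
  qed
qed

lemma measurable_mesh [measurable]: "mesh n \<in> borel_measurable tree_measure"
proof (induction n)
  case (Suc n)
  have [measurable]: "(\<lambda>Y. mesh n (subtree b Y)) \<in> borel_measurable tree_measure" for b
    by (rule measurable_compose[OF measurable_subtree Suc])
  show ?case by simp
qed (simp add: mesh.simps(1)[abs_def])

lemma measurable_good: "{Y. good Y} \<in> sets tree_measure"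
proof -
  have "Measurable.pred tree_measure (\<lambda>Y. \<forall>s. Y s \<in> {0<..<1})"
    by measurable
  moreover have "Measurable.pred tree_measure (\<lambda>Y. (\<lambda>n. mesh n Y) \<longlonglongrightarrow> 0)"
    by measurable
  ultimately have "Measurable.pred tree_measure good"
    unfolding good_def by (rule pred_intros_logic)
  then show ?thesis by (simp add: pred_def)
qed

section \<open>Interval properties along the random homeomorphism\<close>

definition interval_event ::
  "((real \<Rightarrow>\<^sub>C 'b::{real_normed_field, euclidean_space}) \<Rightarrow> real set \<Rightarrow> nat) \<Rightarrow> (real \<Rightarrow>\<^sub>C 'b)
    \<Rightarrow> real \<Rightarrow> real \<Rightarrow> (bool list \<Rightarrow> real) set" where
  "interval_event T f x y = {Y. good Y \<and> T (stretch f x y (phi Y)) {0..1/2} = 1}"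

text \<open>The scaling axiom for increasing maps, with the image condition reduced to two equations
  for endpoints.\<close>

lemma interval_property_affine:
  assumes "interval_property T" "f \<in> circle_fun" "g \<in> circle_fun" "0 < a"
    "0 \<le> x" "x \<le> y" "y \<le> 1" "0 \<le> x'" "x' \<le> y'" "y' \<le> 1" "a * x' + b = x" "a * y' + b = y"
    "\<And>u. x' \<le> u \<Longrightarrow> u \<le> y' \<Longrightarrow> g u = f (a * u + b)"
  shows "T g {x'..y'} = T f {x..y}"
proof -
  have "(\<lambda>u. a * u + b) ` {x'..y'} = {x..y}"
    using image_affinity_atLeastAtMost[of a b x' y'] assms(4,9,11,12) by auto
  moreover have "\<forall>u\<in>{x'..y'}. g u = f (a * u + b)" using assms(13) by auto
  moreover have "a \<noteq> 0" using assms(4) by simp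
  ultimately show ?thesis
    using assms(1-3,5-10) unfolding interval_property_def by blast
qed

lemma interval_property_split:
  assumes "interval_property T" "f \<in> circle_fun" "0 \<le> x" "x \<le> t" "t \<le> y" "y \<le> 1"
  shows "T f {x..y} = T f {x..t} * T f {t..y}"
  using assms(1)[unfolded interval_property_def, THEN conjunct2, THEN conjunct2, THEN conjunct2, THEN conjunct1]
    assms(2-) by blast

lemma interval_property_stretch_split:
  assumes T: "interval_property T" and Y: "good Y"
  defines "z \<equiv> \<lambda>x y. x + Y [] * (y - x)"
  shows "T (stretch f x y (phi Y)) {0..1/2} =
    T (stretch f x (z x y) (phi (subtree False Y))) {0..1/2} * T (stretch f (z x y) y (phi (subtree True Y))) {0..1/2}"
proof -
  let ?g = "stretch f x y (phi Y)"
  let ?l = "stretch f x (z x y) (phi (subtree False Y))"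
  let ?r = "stretch f (z x y) y (phi (subtree True Y))"
  have c: "continuous_on {0..1} (phi Y)" "continuous_on {0..1} (phi (subtree b Y))" for b
    using Y good_subtree by (auto intro!: continuous_on_phi)
  \<comment> \<open>Since \<open>tent\<close> doubles, the argument of \<open>phi Y\<close> reaches
    the midpoint at 1/4. The maps \<open>2 * u\<close> and \<open>2 * u - 1/2\<close> stretch the
    two quarters back to \<open>{0..1/2}\<close>.\<close>
  have "T ?g {0..1/2} = T ?g {0..1/4} * T ?g {1/4..1/2}"
    by (rule interval_property_split[OF T stretch_in_circle_fun[OF c(1)]]) auto
  also have "T ?g {0..1/4} = T ?l {0..1/2}"
  proof (rule interval_property_affine[OF T, where a = 2 and b = 0])
    fix u :: real assume u: "0 \<le> u" "u \<le> 1/4"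
    have "phi Y (2 * u) = Y [] * phi (subtree False Y) (2 * (2 * u))"
      using u by (intro phi_left Y) auto
    then show "?g u = ?l (2 * u + 0)"
      using u by (simp add: stretch_apply c tent_eq z_def algebra_simps)
  qed (auto intro!: stretch_in_circle_fun c)
  also have "T ?g {1/4..1/2} = T ?r {0..1/2}"
  proof (rule interval_property_affine[OF T, where a = 2 and b = "- 1/2"])
    fix u :: real assume u: "1/4 \<le> u" "u \<le> 1/2"
    have "phi Y (2 * u) = Y [] + (1 - Y []) * phi (subtree True Y) (2 * (2 * u) - 1)"
      using u by (intro phi_right Y) auto
    moreover have "tent (2 * u + - 1/2) = 2 * (2 * u) - 1"
      using u by (subst tent_eq) (auto simp: algebra_simps)
    ultimately show "?g u = ?r (2 * u + - 1/2)"
      using u by (simp add: stretch_apply c tent_eq z_def) (simp add: algebra_simps)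
  qed (auto intro!: stretch_in_circle_fun c)
  finally show ?thesis .
qed

text \<open>A pointwise limit of measurable maps into the function space. On trees that are not
  good, the constant function with value \<open>f 0\<close> stands in, so that every value is known
  to lie in \<open>circle_fun\<close>.\<close>

lemma measurable_stretch_phi:
  fixes f :: "real \<Rightarrow>\<^sub>C 'b::{real_normed_field, euclidean_space}"
  shows "(\<lambda>w. if good (snd w) then stretch f (fst (fst w)) (snd (fst w)) (phi (snd w)) else stretch f 0 0 (\<lambda>s. s))
    \<in> borel_measurable ((borel \<Otimes>\<^sub>M borel) \<Otimes>\<^sub>M tree_measure)"
proof (rule borel_measurable_LIMSEQ_metric)
  let ?M = "(borel \<Otimes>\<^sub>M borel) \<Otimes>\<^sub>M tree_measure :: ((real \<times> real) \<times> (bool list \<Rightarrow> real)) measure"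
  fix n
  have "sets ?M = sets ((borel :: (real \<times> real) measure) \<Otimes>\<^sub>M (borel :: (bool list \<Rightarrow> real) measure))"
    by (rule sets_pair_measure_cong) (simp_all only: borel_prod sets_tree_measure_eq_borel)
  also have "\<dots> = sets borel"
    by (simp only: borel_prod)
  finally have "sets ?M = sets borel" .
  then have "(\<lambda>w. stretch f (fst (fst w)) (snd (fst w)) (approx n (snd w))) \<in> borel_measurable ?M"
    using borel_measurable_continuous_onI[OF continuous_stretch_approx] by (simp cong: measurable_cong_sets)
  moreover have "Measurable.pred ?M (\<lambda>w. good (snd w))"
    using measurable_sets[OF measurable_snd measurable_good, of "borel \<Otimes>\<^sub>M borel"]
    by (simp add: pred_def vimage_def Int_def conj_commute)
  ultimately show "(\<lambda>w. if good (snd w) then stretch f (fst (fst w)) (snd (fst w)) (approx n (snd w)) else stretch f 0 0 (\<lambda>s. s))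
    \<in> borel_measurable ?M"
    by (intro measurable_If) (auto simp: pred_def)
next
  fix w :: "(real \<times> real) \<times> (bool list \<Rightarrow> real)"
  show "(\<lambda>n. if good (snd w) then stretch f (fst (fst w)) (snd (fst w)) (approx n (snd w)) else stretch f 0 0 (\<lambda>s. s))
    \<longlonglongrightarrow> (if good (snd w) then stretch f (fst (fst w)) (snd (fst w)) (phi (snd w)) else stretch f 0 0 (\<lambda>s. s))"
    by (auto intro: stretch_approx_tendsto)
qed

lemma measurable_interval_event:
  fixes f :: "real \<Rightarrow>\<^sub>C 'b::{real_normed_field, euclidean_space}"
  assumes T: "interval_property T"
  shows "{w \<in> space ((borel \<Otimes>\<^sub>M borel) \<Otimes>\<^sub>M tree_measure). snd w \<in> interval_event T f (fst (fst w)) (snd (fst w))}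
    \<in> sets ((borel \<Otimes>\<^sub>M borel) \<Otimes>\<^sub>M tree_measure)"
proof -
  let ?M = "(borel \<Otimes>\<^sub>M borel) \<Otimes>\<^sub>M tree_measure :: ((real \<times> real) \<times> (bool list \<Rightarrow> real)) measure"
  let ?G = "\<lambda>w. if good (snd w) then stretch f (fst (fst w)) (snd (fst w)) (phi (snd w)) else stretch f 0 0 (\<lambda>s. s)"
  let ?S = "circle_fun \<times> {(x, y). 0 \<le> x \<and> x \<le> y \<and> y \<le> 1} :: ((real \<Rightarrow>\<^sub>C 'b) \<times> real \<times> real) set"
  have "continuous_on UNIV (\<lambda>g :: real \<Rightarrow>\<^sub>C 'b. (g, 0::real, 1/2::real))"
    by (intro continuous_intros)
  from measurable_compose[OF measurable_stretch_phi borel_measurable_continuous_onI[OF this], of f]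
  have "(\<lambda>w. (?G w, 0, 1/2)) \<in> measurable ?M (borel :: ((real \<Rightarrow>\<^sub>C 'b) \<times> real \<times> real) measure)" .
  moreover have "?G w \<in> circle_fun" for w
    by (auto intro!: stretch_in_circle_fun continuous_on_phi continuous_intros)
  ultimately have G: "(\<lambda>w. (?G w, 0, 1/2)) \<in> measurable ?M (restrict_space borel ?S)"
    by (intro measurable_restrict_space2) auto
  have "(\<lambda>(f, x, y). T f {x..y}) \<in> borel_measurable (restrict_space borel ?S)"
    using T[unfolded interval_property_def, THEN conjunct2, THEN conjunct1] .
  from measurable_compose[OF G this] have "(\<lambda>w. T (?G w) {0..1/2}) \<in> borel_measurable ?M"
    by simp
  then have "(\<lambda>w. T (?G w) {0..1/2}) -` {1} \<inter> space ?M \<in> sets ?M"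
    by (rule measurable_sets) simp
  moreover have "snd -` {Y. good Y} \<inter> space ?M \<in> sets ?M"
    by (rule measurable_sets[OF measurable_snd measurable_good])
  ultimately have "((\<lambda>w. T (?G w) {0..1/2}) -` {1} \<inter> space ?M) \<inter> (snd -` {Y. good Y} \<inter> space ?M) \<in> sets ?M"
    by (rule sets.Int)
  also have "((\<lambda>w. T (?G w) {0..1/2}) -` {1} \<inter> space ?M) \<inter> (snd -` {Y. good Y} \<inter> space ?M)
    = {w \<in> space ?M. snd w \<in> interval_event T f (fst (fst w)) (snd (fst w))}"
    by (auto simp: interval_event_def)
  finally show ?thesis .
qed

lemma split_event_interval_event:
  assumes "interval_property T"
  shows "split_event (interval_event T f)"
proof
  show "{w \<in> space ((borel \<Otimes>\<^sub>M borel) \<Otimes>\<^sub>M tree_measure). snd w \<in> interval_event T f (fst (fst w)) (snd (fst w))}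
    \<in> sets ((borel \<Otimes>\<^sub>M borel) \<Otimes>\<^sub>M tree_measure)"
    by (rule measurable_interval_event[OF assms])
  fix Y x y
  show "Y \<in> interval_event T f x y \<longleftrightarrow> Y [] \<in> {0<..<1} \<and> subtree False Y \<in> interval_event T f x (x + Y [] * (y - x)) \<and>
      subtree True Y \<in> interval_event T f (x + Y [] * (y - x)) y"
  proof (cases "good Y")
    case True
    \<comment> \<open>The values of \<open>T\<close> are natural numbers, so the product is 1 only
      if both factors are.\<close>
    then show ?thesis
      using interval_property_stretch_split[OF assms True, of f x y] good_iff[of Y]
      by (auto simp: interval_event_def)
  next
    case False
    then show ?thesis
      using good_iff[of Y] by (auto simp: interval_event_def)
  qed
qed

text \<open>An instance that is constant in the endpoints: it shows that good trees have probability
  0 or 1, which controls the part of the event that comes from the default map.\<close>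

lemma split_event_good: "split_event (\<lambda>_ _. {Y. good Y})"
proof
  let ?M = "(borel \<Otimes>\<^sub>M borel) \<Otimes>\<^sub>M tree_measure :: ((real \<times> real) \<times> (bool list \<Rightarrow> real)) measure"
  have "snd -` {Y. good Y} \<inter> space ?M \<in> sets ?M"
    by (rule measurable_sets[OF measurable_snd measurable_good])
  also have "snd -` {Y. good Y} \<inter> space ?M = {w \<in> space ?M. snd w \<in> {Y. good Y}}" by auto
  finally show "{w \<in> space ?M. snd w \<in> {Y. good Y}} \<in> sets ?M" .
qed (use good_iff in blast)

section \<open>Transfer to the given random variables\<close>

text \<open>Independence identifies the joint law of the family with a product of uniform measures.
  The tree reads this family along an injective indexing by words, and injective reindexing
  preserves such products.\<close>

lemma distr_tree:
  fixes M :: "'w measure" and X :: "nat \<Rightarrow> nat \<Rightarrow> 'w \<Rightarrow> real"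
  assumes M: "prob_space M"
    and indep: "prob_space.indep_vars M (\<lambda>_. borel) (\<lambda>(n, k). X n k) {(n, k). 1 \<le> n \<and> odd k \<and> k < 2 ^ n}"
    and uniform: "\<And>n k. 1 \<le> n \<Longrightarrow> odd k \<Longrightarrow> k < 2 ^ n \<Longrightarrow> distr M borel (X n k) = uniform_measure lborel {0..1}"
  defines "Z \<equiv> \<lambda>\<omega> s. X (length s + 1) (2 * node_index s + 1) \<omega>"
  shows "Z \<in> measurable M tree_measure" "distr M tree_measure Z = tree_measure"
proof -
  interpret prob_space M by (rule M)
  define J :: "(nat \<times> nat) set" where "J = {(n, k). 1 \<le> n \<and> odd k \<and> k < 2 ^ n}"
  define node :: "bool list \<Rightarrow> nat \<times> nat" where "node s = (length s + 1, 2 * node_index s + 1)" for s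
  define V where "V = (\<lambda>(n, k). X n k)"
  have indepV: "indep_vars (\<lambda>_. borel) V J"
    using indep by (simp add: V_def J_def)
  then have rv: "random_variable borel (V j)" if "j \<in> J" for j
    using that unfolding indep_vars_def by blast
  have uniformV: "distr M borel (V j) = unif" if "j \<in> J" for j
    using uniform that by (auto simp: V_def J_def unif_def)
  have J: "node s \<in> J" for s
    using node_index_less[of s] by (simp add: J_def node_def)
  have inj: "inj node"
  proof (rule injI)
    fix s s' assume "node s = node s'"
    then have "length s = length s'" "node_index s = node_index s'" by (simp_all add: node_def)
    then show "s = s'" by (metis dyadic_path_index)
  qed
  have Z_eq: "Z \<omega> s = V (node s) \<omega>" for \<omega> s
    by (simp add: Z_def V_def node_def)
  have "(\<lambda>\<omega>. Z \<omega> s) \<in> borel_measurable M" for s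
    unfolding Z_eq using rv[OF J] by simp
  then show "Z \<in> measurable M tree_measure"
    by (rule measurable_tree_measureI)
  have V: "(\<lambda>\<omega>. \<lambda>j\<in>J. V j \<omega>) \<in> measurable M (PiM J (\<lambda>_. unif))"
    using rv by (intro measurable_restrict) (simp cong: measurable_cong_sets)
  have R: "(\<lambda>v. \<lambda>s\<in>UNIV. v (node s)) \<in> measurable (PiM J (\<lambda>_. unif)) (PiM UNIV (\<lambda>_. unif))"
    using J by (intro measurable_restrict measurable_component_singleton)
  have "distr M (PiM J (\<lambda>_. unif)) (\<lambda>\<omega>. \<lambda>j\<in>J. V j \<omega>) = distr M (PiM J (\<lambda>_. borel)) (\<lambda>\<omega>. \<lambda>j\<in>J. V j \<omega>)"
    by (intro distr_cong sets_PiM_cong) auto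
  also have "\<dots> = PiM J (\<lambda>j. distr M borel (V j))"
    using J indepV rv by (subst indep_vars_iff_distr_eq_PiM'[symmetric]) auto
  also have "\<dots> = PiM J (\<lambda>_. unif)"
    by (intro PiM_cong uniformV) auto
  finally have joint: "distr M (PiM J (\<lambda>_. unif)) (\<lambda>\<omega>. \<lambda>j\<in>J. V j \<omega>) = PiM J (\<lambda>_. unif)" .
  have "distr M tree_measure Z = distr M tree_measure ((\<lambda>v. \<lambda>s\<in>UNIV. v (node s)) \<circ> (\<lambda>\<omega>. \<lambda>j\<in>J. V j \<omega>))"
    using J by (intro arg_cong[where f = "distr M tree_measure"]) (auto simp: fun_eq_iff Z_eq)
  also have "\<dots> = distr (distr M (PiM J (\<lambda>_. unif)) (\<lambda>\<omega>. \<lambda>j\<in>J. V j \<omega>)) tree_measure (\<lambda>v. \<lambda>s\<in>UNIV. v (node s))"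
    using R V by (intro distr_distr[symmetric]) (auto simp: tree_measure_def)
  also have "\<dots> = tree_measure"
    unfolding joint tree_measure_def using inj J by (intro distr_PiM_reindex prob_space_unif) auto
  finally show "distr M tree_measure Z = tree_measure" .
qed

text \<open>Halving maps \<open>[0, 1]\<close> onto \<open>[0, 1/2]\<close>, where
  \<open>tent\<close> undoes it.\<close>

lemma interval_property_circle_comp:
  assumes T: "interval_property T" and f: "f \<in> circle_fun" and Y: "good Y"
  shows "T (circle_comp f (random_homeo (dyadic_array Y))) {0..1} = T (stretch f 0 1 (phi Y)) {0..1/2}"
proof -
  let ?h = "random_homeo (dyadic_array Y)"
  have eq: "?h s = phi Y s" if "s \<in> {0..1}" for s
    by (rule random_homeo_eq_phi[OF Y that])
  have h: "continuous_on {0..1} ?h" "?h 0 = 0" "?h 1 = 1"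
    using continuous_on_eq[OF continuous_on_phi[OF Y]] eq phi_0[OF Y] phi_1[OF Y] by simp_all
  show ?thesis
  proof (rule interval_property_affine[OF T, where a = "1/2" and b = 0])
    show "stretch f 0 1 (phi Y) \<in> circle_fun" by (intro stretch_in_circle_fun continuous_on_phi Y)
    show "circle_comp f ?h \<in> circle_fun" by (rule circle_comp_in_circle_fun[OF f h])
    fix u :: real assume "0 \<le> u" "u \<le> 1"
    then show "circle_comp f ?h u = stretch f 0 1 (phi Y) (1/2 * u + 0)"
      using circle_comp_apply[OF f h, of u]
      by (simp add: eq stretch_apply continuous_on_phi Y tent_eq)
  qed auto
qed

theorem theorem3:
  fixes M :: "'w measure"
    and X :: "nat \<Rightarrow> nat \<Rightarrow> 'w \<Rightarrow> real"
    and T :: "(real \<Rightarrow>\<^sub>C 'b::{real_normed_field, euclidean_space}) \<Rightarrow> real set \<Rightarrow> nat"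
    and f :: "real \<Rightarrow>\<^sub>C 'b"
  assumes "prob_space M"
    and "prob_space.indep_vars M (\<lambda>_. borel) (\<lambda>(n, k). X n k)
           {(n, k). 1 \<le> n \<and> odd k \<and> k < 2 ^ n}"
    and "\<And>n k. 1 \<le> n \<Longrightarrow> odd k \<Longrightarrow> k < 2 ^ n \<Longrightarrow>
           distr M borel (X n k) = uniform_measure lborel {0..1}"
    and "interval_property T"
    and "f \<in> circle_fun"
  shows "let E = {\<omega> \<in> space M.
             T (circle_comp f (random_homeo (\<lambda>n k. X n k \<omega>))) {0..1} = 1}
         in E \<in> sets M \<and> measure M E \<in> {0, 1}"
proof -
  interpret T: prob_space tree_measure by (rule prob_space_tree_measure)
  interpret E: split_event "interval_event T f" by (rule split_event_interval_event[OF assms(4)])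
  interpret G: split_event "\<lambda>_ _. {Y. good Y}" by (rule split_event_good)
  define Z where "Z = (\<lambda>\<omega> s. X (length s + 1) (2 * node_index s + 1) \<omega>)"
  note Z = distr_tree[OF assms(1-3), folded Z_def]
  \<comment> \<open>On trees that are not good the map is the identity, so there the event holds
    everywhere or nowhere, according to the value of \<open>T\<close> for \<open>f\<close>
    itself.\<close>
  define F where "F = interval_event T f 0 1 \<union>
    (if T (circle_comp f (\<lambda>x. x)) {0..1} = 1 then UNIV - {Y. good Y} else {})"
  have F [measurable]: "F \<in> sets tree_measure"
    unfolding F_def by (auto intro!: sets.Un sets.Diff E.sets_event measurable_good)
  have zero_one: "measure tree_measure F \<in> {0, 1}"
  proof (cases "T (circle_comp f (\<lambda>x. x)) {0..1} = 1")
    case True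
    then have "measure tree_measure F = measure tree_measure (interval_event T f 0 1 \<union> (UNIV - {Y. good Y}))"
      by (simp add: F_def)
    also have "\<dots> = measure tree_measure (interval_event T f 0 1) + measure tree_measure (UNIV - {Y. good Y})"
    proof (rule T.finite_measure_Union)
      show "interval_event T f 0 1 \<inter> (UNIV - {Y. good Y}) = {}" by (auto simp: interval_event_def)
    qed (auto intro: E.sets_event measurable_good)
    also have "measure tree_measure (UNIV - {Y. good Y}) = 1 - measure tree_measure {Y. good Y}"
      using T.prob_compl[OF measurable_good] by simp
    finally have "measure tree_measure F = measure tree_measure (interval_event T f 0 1) + (1 - measure tree_measure {Y. good Y})" .
    \<comment> \<open>If good trees have measure 0, so has the interval event and the sum is 1; if
      they have measure 1, the sum is the measure of the interval event.\<close>
    moreover have "measure tree_measure (interval_event T f 0 1) \<le> measure tree_measure {Y. good Y}"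
      by (rule T.finite_measure_mono) (auto simp: interval_event_def measurable_good)
    ultimately show ?thesis
      using E.measure_event_zero_one[of 0 1] G.measure_event_zero_one by auto
  next
    case False
    then show ?thesis
      using E.measure_event_zero_one[of 0 1] by (simp add: F_def)
  qed
  have "T (circle_comp f (random_homeo (\<lambda>n k. X n k \<omega>))) {0..1} = 1 \<longleftrightarrow> Z \<omega> \<in> F" for \<omega>
  proof -
    have "random_homeo (\<lambda>n k. X n k \<omega>) = random_homeo (dyadic_array (Z \<omega>))"
      by (rule random_homeo_cong) (simp add: Z_def dyadic_array_index[where X = "\<lambda>n k. X n k \<omega>", simplified])
    then show ?thesis
      using interval_property_circle_comp[OF assms(4,5), of "Z \<omega>"] random_homeo_not_good[of "Z \<omega>"]
      by (cases "good (Z \<omega>)") (auto simp: F_def interval_event_def)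
  qed
  then have eq: "{\<omega> \<in> space M. T (circle_comp f (random_homeo (\<lambda>n k. X n k \<omega>))) {0..1} = 1} = Z -` F \<inter> space M"
    by auto
  have "measure M (Z -` F \<inter> space M) = measure tree_measure F"
    using measure_distr[OF Z(1) F] Z(2) by simp
  then show ?thesis
    unfolding eq Let_def using zero_one measurable_sets[OF Z(1) F] by simp
qed

end
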